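(* Suppose that $\|x^0-x^\star\|_{x^\star}\le\beta$. Let $(\sigma,\beta,C)$ satisfy $$\sigma\in(0,1),\quad \beta\in(0,0.5),\quad C>1,\qquad \frac{1}{C(1-\beta)}+\frac{\beta}{(1-2\beta)(1-\beta)^2}\le\sigma,\qquad \frac1C+\frac{1}{1-2\beta}\le 2,$$ let $\eta_k:=\frac{\beta\sigma^k}{C}$, and let $\{x^k\}$ be updated by the full-step scheme described in the context. Then, for all $k\ge 0$, $$f(x^{k+1})-f(x^\star)\le\left(\frac{12\beta^3}{1-2\beta}+\frac{\beta^2}{C^2}+\beta^2\right)\sigma^{2k}.$$ Consequently, the total number of LMO calls needed by the scheme to achieve a point $x_\varepsilon^\star$ such that $f(x_\varepsilon^\star)-f^\star\le\varepsilon$ is $\mathcal{O}(\varepsilon^{-\nu})$, where $\nu:=1+\frac{\ln(1-2\beta)}{\ln(\sigma)}$.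
   Context: Problem. Let $f:\mathbb{R}^p\to\mathbb{R}\cup\{+\infty\}$ be a proper, closed, convex function, three times continuously differentiable on its domain $\mathrm{dom}(f)$, and standard self-concordant: for all $x\in\mathrm{dom}(f)$, $v\in\mathbb{R}^p$, the function $\varphi(\tau):=f(x+\tau v)$ satisfies $|\varphi'''(\tau)|\le 2\varphi''(\tau)^{3/2}$ for all $\tau\in\mathrm{dom}(\varphi)$. The Hessian $\nabla^2 f(x)$ is nondegenerate (hence positive definite) for every $x\in\mathrm{dom}(f)$. Let $\mathcal{X}\subset\mathbb{R}^p$ be nonempty, compact and convex. The problem $f^\star=\min_{x\in\mathcal{X}}f(x)$ has a (necessarily unique) solution $x^\star$. Notation: $\|u\|_x := (u^\top\nabla^2 f(x)u)^{1/2}$. An LMO (linear minimization oracle) call returns, for given $s$, a point of $\arg\min_{u\in\mathcal{X}}\langle s,u\rangle$. Subroutine $\mathbf{FW}(q,H,u^0,\eta)$ ($q,u^0\in\mathbb{R}^p$, $H$ a symmetric positive definite matrix, $\eta>0$): for $t=0,1,\dots$: set $g^t:=q+H(u^t-u^0)$; choose $v^t\in\arg\max_{s\in\mathcal{X}}\langle g^t,u^t-s\rangle$ (one LMO call); set $V_t:=\langle g^t,u^t-v^t\rangle$. If $V_t>\eta$, set $\delta_t:=(v^t-u^t)^\top H(v^t-u^t)$, $\tau_t:=\min\{1,V_t/\delta_t\}$, $u^{t+1}:=(1-\tau_t)u^t+\tau_tv^t$; otherwise return $u^t$. Full-step scheme: starting from $x^0\in\mathrm{dom}(f)\cap\mathcal{X}$,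 for $k=0,1,\dots$ set $z^k:=\mathbf{FW}(\nabla f(x^k),\nabla^2f(x^k),x^k,\eta_k^2)$ and $x^{k+1}:=z^k$. LMO calls are counted over all FW runs. The $\mathcal{O}(\cdot)$ bound is for small $\varepsilon>0$, with constant independent of $\varepsilon$ (it may depend on $f,\mathcal{X},x^0,\beta,\sigma,C$). *)

theory Defs
  imports "HOL-Analysis.Analysis" "HOL-Library.Landau_Symbols"
begin

text \<open>Convex functions \<open>\<real>\<^sup>p \<rightarrow> \<real> \<union> {+\<infinity>}\<close> are \<open>ereal\<close>-valued; \<open>proper_fun\<close> excludes the value \<open>-\<infinity>\<close>.\<close>

definition effdom :: "('a \<Rightarrow> ereal) \<Rightarrow> 'a set" where
  "effdom f = {x. f x < \<infinity>}"

definition eepigraph :: "('a \<Rightarrow> ereal) \<Rightarrow> ('a \<times> real) set" where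
  "eepigraph f = {(x, r). f x \<le> ereal r}"

definition proper_fun :: "('a \<Rightarrow> ereal) \<Rightarrow> bool" where
  "proper_fun f \<longleftrightarrow> effdom f \<noteq> {} \<and> (\<forall>x. f x \<noteq> -\<infinity>)"

definition closed_fun :: "('a::topological_space \<Rightarrow> ereal) \<Rightarrow> bool" where
  "closed_fun f \<longleftrightarrow> closed (eepigraph f)"

definition convex_fun :: "('a::real_vector \<Rightarrow> ereal) \<Rightarrow> bool" where
  "convex_fun f \<longleftrightarrow> convex (eepigraph f)"

text \<open>The real-valued representative of \<open>f\<close>; it agrees with \<open>f\<close> on \<open>effdom f\<close> when \<open>f\<close> is proper.\<close>

definition real_part :: "('a \<Rightarrow> ereal) \<Rightarrow> 'a \<Rightarrow> real" where
  "real_part f x = real_of_ereal (f x)"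

text \<open>\<open>n\<close>-fold continuous differentiability, by iterated directional derivatives; meant for
  open \<open>S\<close> and finite-dimensional domain type.\<close>

primrec C_on :: "nat \<Rightarrow> ('a::euclidean_space \<Rightarrow> real) \<Rightarrow> 'a set \<Rightarrow> bool" where
  "C_on 0 F S \<longleftrightarrow> continuous_on S F"
| "C_on (Suc n) F S \<longleftrightarrow> (\<forall>x\<in>S. F differentiable (at x)) \<and>
     (\<forall>v. C_on n (\<lambda>x. frechet_derivative F (at x) v) S)"

definition grad :: "(real^'n \<Rightarrow> ereal) \<Rightarrow> real^'n \<Rightarrow> real^'n" where
  "grad f x = (THE D. GDERIV (real_part f) x :> D)"

definition hess :: "(real^'n \<Rightarrow> ereal) \<Rightarrow> real^'n \<Rightarrow> real^'n^'n" where
  "hess f x = jacobian (grad f) (at x)"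

definition local_norm :: "(real^'n \<Rightarrow> ereal) \<Rightarrow> real^'n \<Rightarrow> real^'n \<Rightarrow> real" where
  "local_norm f x u = sqrt (u \<bullet> (hess f x *v u))"

definition std_self_concordant :: "('a::real_vector \<Rightarrow> ereal) \<Rightarrow> bool" where
  "std_self_concordant f \<longleftrightarrow>
     (\<forall>x\<in>effdom f. \<forall>v. let \<phi> = (\<lambda>\<tau>. real_part f (x + \<tau> *\<^sub>R v)) in
        \<forall>\<tau>. x + \<tau> *\<^sub>R v \<in> effdom f \<longrightarrow>
          \<bar>(deriv ^^ 3) \<phi> \<tau>\<bar> \<le> 2 * ((deriv ^^ 2) \<phi> \<tau>) powr (3/2))"


text \<open>The Frank--Wolfe subroutine. Since the oracle may return any optimal point, runs are
  described relationally by the inner iterates \<open>u\<close> and the oracle answers \<open>v\<close>.\<close>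

definition fw_grad :: "real^'n \<Rightarrow> real^'n^'n \<Rightarrow> real^'n \<Rightarrow> real^'n \<Rightarrow> real^'n" where
  "fw_grad q H u0 u = q + H *v (u - u0)"

definition fw_gap :: "real^'n \<Rightarrow> real^'n^'n \<Rightarrow> real^'n \<Rightarrow> real^'n \<Rightarrow> real^'n \<Rightarrow> real" where
  "fw_gap q H u0 u v = fw_grad q H u0 u \<bullet> (u - v)"

definition fw_step :: "real^'n \<Rightarrow> real^'n^'n \<Rightarrow> real^'n \<Rightarrow> real^'n \<Rightarrow> real^'n \<Rightarrow> real^'n" where
  "fw_step q H u0 u v =
     (let \<delta> = (v - u) \<bullet> (H *v (v - u)); \<tau> = min 1 (fw_gap q H u0 u v / \<delta>)
      in (1 - \<tau>) *\<^sub>R u + \<tau> *\<^sub>R v)"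

text \<open>The sequences are constrained only up to the first index at which the stopping test succeeds
  (at every index, should the run not terminate).\<close>

definition fw_run :: "(real^'n) set \<Rightarrow> real^'n \<Rightarrow> real^'n^'n \<Rightarrow> real^'n \<Rightarrow> real \<Rightarrow>
    (nat \<Rightarrow> real^'n) \<Rightarrow> (nat \<Rightarrow> real^'n) \<Rightarrow> bool" where
  "fw_run X q H u0 \<eta> u v \<longleftrightarrow> u 0 = u0 \<and>
     (\<forall>t. (\<forall>s<t. fw_gap q H u0 (u s) (v s) > \<eta>) \<longrightarrow>
        is_arg_max (\<lambda>s. fw_grad q H u0 (u t) \<bullet> (u t - s)) (\<lambda>s. s \<in> X) (v t) \<and>
        (fw_gap q H u0 (u t) (v t) > \<eta> \<longrightarrow> u (Suc t) = fw_step q H u0 (u t) (v t)))"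

definition fw_stops_at :: "real^'n \<Rightarrow> real^'n^'n \<Rightarrow> real^'n \<Rightarrow> real \<Rightarrow>
    (nat \<Rightarrow> real^'n) \<Rightarrow> (nat \<Rightarrow> real^'n) \<Rightarrow> nat \<Rightarrow> bool" where
  "fw_stops_at q H u0 \<eta> u v t \<longleftrightarrow>
     fw_gap q H u0 (u t) (v t) \<le> \<eta> \<and> (\<forall>s<t. fw_gap q H u0 (u s) (v s) > \<eta>)"


text \<open>Executions of the full-step scheme: \<open>u k\<close> and \<open>v k\<close> belong to the \<open>k\<close>-th call of the subroutine.
  Termination of the calls is not built in: if the \<open>k\<close>-th call ran forever, \<open>x (Suc k)\<close> would be
  arbitrary.\<close>

definition stage_stops_at :: "(real^'n \<Rightarrow> ereal) \<Rightarrow> (nat \<Rightarrow> real) \<Rightarrow> (nat \<Rightarrow> real^'n) \<Rightarrow>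
    (nat \<Rightarrow> nat \<Rightarrow> real^'n) \<Rightarrow> (nat \<Rightarrow> nat \<Rightarrow> real^'n) \<Rightarrow> nat \<Rightarrow> nat \<Rightarrow> bool" where
  "stage_stops_at f \<eta> x u v k t \<longleftrightarrow>
     fw_stops_at (grad f (x k)) (hess f (x k)) (x k) ((\<eta> k)\<^sup>2) (u k) (v k) t"

definition full_step_scheme :: "(real^'n \<Rightarrow> ereal) \<Rightarrow> (real^'n) set \<Rightarrow> real^'n \<Rightarrow> (nat \<Rightarrow> real) \<Rightarrow>
    (nat \<Rightarrow> real^'n) \<Rightarrow> (nat \<Rightarrow> nat \<Rightarrow> real^'n) \<Rightarrow> (nat \<Rightarrow> nat \<Rightarrow> real^'n) \<Rightarrow> bool" where
  "full_step_scheme f X x0 \<eta> x u v \<longleftrightarrow> x 0 = x0 \<and>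
     (\<forall>k. fw_run X (grad f (x k)) (hess f (x k)) (x k) ((\<eta> k)\<^sup>2) (u k) (v k) \<and>
          (\<forall>t. stage_stops_at f \<eta> x u v k t \<longrightarrow> x (Suc k) = u k t))"

text \<open>A call stopping at index \<open>t\<close> has queried the oracle for \<open>v 0, \<dots>, v t\<close>, i.e. \<open>Suc t\<close> times.
  The counts are meaningful only for terminating calls.\<close>

definition stage_lmo_calls :: "(real^'n \<Rightarrow> ereal) \<Rightarrow> (nat \<Rightarrow> real) \<Rightarrow> (nat \<Rightarrow> real^'n) \<Rightarrow>
    (nat \<Rightarrow> nat \<Rightarrow> real^'n) \<Rightarrow> (nat \<Rightarrow> nat \<Rightarrow> real^'n) \<Rightarrow> nat \<Rightarrow> nat" where
  "stage_lmo_calls f \<eta> x u v k = Suc (THE t. stage_stops_at f \<eta> x u v k t)"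

definition lmo_calls_before :: "(real^'n \<Rightarrow> ereal) \<Rightarrow> (nat \<Rightarrow> real) \<Rightarrow> (nat \<Rightarrow> real^'n) \<Rightarrow>
    (nat \<Rightarrow> nat \<Rightarrow> real^'n) \<Rightarrow> (nat \<Rightarrow> nat \<Rightarrow> real^'n) \<Rightarrow> nat \<Rightarrow> nat" where
  "lmo_calls_before f \<eta> x u v k = (\<Sum>j<k. stage_lmo_calls f \<eta> x u v j)"

end

theory Submission
  imports Defs
begin

text \<open>Along a segment \<open>x + t v\<close>, self-concordance makes \<open>1 / \<parallel>v\<parallel>\<close> (in the norm at the moving point)
  \<open>1\<close>-Lipschitz in \<open>t\<close>. Banach's bound on symmetric trilinear forms turns the diagonal bound on the third
  derivative into one on \<open>D\<^sup>3f(u, u, v)\<close>, so Hessians at points of local distance \<open>r\<close> compare with the factor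
  \<open>(1 - r)\<^sup>2\<close>, and the error of the linearised gradient is at most \<open>r\<^sup>2 / (1 - r)\<close> in the dual local norm.

  Let \<open>x\<close> be the current and \<open>z\<close> the next iterate. Adding the inexact optimality of \<open>z\<close> for the quadratic
  model, tested at the solution \<open>y\<close>, to the optimality of \<open>y\<close>, tested at \<open>z\<close>, gives
  \<open>\<parallel>z - y\<parallel>\<^sub>x \<le> \<eta> + r\<^sup>2 / ((1 - r) (1 - 2 r))\<close> with \<open>r = \<parallel>x - y\<parallel>\<^sub>y\<close>, and the condition on \<open>(\<sigma>, \<beta>, C)\<close> says that
  this contracts \<open>r\<close> by \<open>\<sigma>\<close>. In the comparison of \<open>f(z)\<close> with \<open>f(y)\<close> through the model at \<open>x\<close>, the squares of
  \<open>\<parallel>z - x\<parallel>\<^sub>x\<close> cancel, which leaves the bound on the objective.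

  Stage \<open>k\<close> solves its subproblem to accuracy \<open>\<eta>\<^sub>k\<^sup>2\<close> with \<open>O(\<sigma>\<^bsup>-2k\<^esup>)\<close> oracle calls. These numbers grow
  geometrically and the accuracy after stage \<open>k\<close> is of order \<open>\<sigma>\<^bsup>2k\<^esup>\<close>, so the total is \<open>O(1/\<epsilon>)\<close>, which is
  stronger than the claim because \<open>\<nu> \<ge> 1\<close>.\<close>

section \<open>Symmetry of second derivatives\<close>

text \<open>The mean value theorem is applied twice: along \<open>v\<close> to the increment of
  \<open>g\<close> in the direction \<open>s *\<^sub>R w\<close>, then along \<open>w\<close> to
  \<open>G y v\<close>. The double difference on the left is symmetric in \<open>v\<close> and
  \<open>w\<close>.\<close>

lemma double_difference_mvt:
  fixes g :: "'a::real_normed_vector \<Rightarrow> real"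
  assumes s: "s > 0"
    and box: "\<And>a b. 0 \<le> a \<Longrightarrow> a \<le> s \<Longrightarrow> 0 \<le> b \<Longrightarrow> b \<le> s \<Longrightarrow> x + a *\<^sub>R v + b *\<^sub>R w \<in> D"
    and g: "\<And>y. y \<in> D \<Longrightarrow> (g has_derivative G y) (at y)"
    and Gv: "\<And>y. y \<in> D \<Longrightarrow> ((\<lambda>y. G y v) has_derivative Gv y) (at y)"
  obtains a b where "0 < a" "a < s" "0 < b" "b < s"
    "g (x + s *\<^sub>R v + s *\<^sub>R w) - g (x + s *\<^sub>R v) - g (x + s *\<^sub>R w) + g x = s * s * Gv (x + a *\<^sub>R v + b *\<^sub>R w) w"
proof -
  define p where "p a = g (x + a *\<^sub>R v + s *\<^sub>R w) - g (x + a *\<^sub>R v)" for a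
  have dp: "(p has_real_derivative (G (x + a *\<^sub>R v + s *\<^sub>R w) v - G (x + a *\<^sub>R v) v)) (at a)"
    if a: "0 \<le> a" "a \<le> s" for a
  proof -
    have i1: "x + a *\<^sub>R v + s *\<^sub>R w \<in> D" using box a s by simp
    have i2: "x + a *\<^sub>R v \<in> D" using box[of a 0] a s by simp
    have l1: "linear (G (x + a *\<^sub>R v + s *\<^sub>R w))" by (rule has_derivative_linear[OF g[OF i1]])
    have l2: "linear (G (x + a *\<^sub>R v))" by (rule has_derivative_linear[OF g[OF i2]])
    have "((\<lambda>a. x + a *\<^sub>R v + s *\<^sub>R w) has_derivative (\<lambda>t. t *\<^sub>R v)) (at a)"
      by (auto intro!: derivative_eq_intros)
    from has_derivative_compose[OF this g[OF i1]]
    have d1: "((\<lambda>a. g (x + a *\<^sub>R v + s *\<^sub>R w)) has_derivative (\<lambda>t. G (x + a *\<^sub>R v + s *\<^sub>R w) (t *\<^sub>R v))) (at a)" .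
    have "((\<lambda>a. x + a *\<^sub>R v) has_derivative (\<lambda>t. t *\<^sub>R v)) (at a)"
      by (auto intro!: derivative_eq_intros)
    from has_derivative_compose[OF this g[OF i2]]
    have d2: "((\<lambda>a. g (x + a *\<^sub>R v)) has_derivative (\<lambda>t. G (x + a *\<^sub>R v) (t *\<^sub>R v))) (at a)" .
    show ?thesis
      unfolding p_def has_field_derivative_def
      using has_derivative_diff[OF d1 d2] linear_scale[OF l1] linear_scale[OF l2]
      by (elim has_derivative_eq_rhs) (auto simp: algebra_simps)
  qed
  obtain a where a: "0 < a" "a < s"
    "p s - p 0 = (s - 0) * (G (x + a *\<^sub>R v + s *\<^sub>R w) v - G (x + a *\<^sub>R v) v)"
    using MVT2[OF s, of p "\<lambda>a. G (x + a *\<^sub>R v + s *\<^sub>R w) v - G (x + a *\<^sub>R v) v"] dp by blast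
  have dq: "((\<lambda>b. G (x + a *\<^sub>R v + b *\<^sub>R w) v) has_real_derivative Gv (x + a *\<^sub>R v + b *\<^sub>R w) w) (at b)"
    if b: "0 \<le> b" "b \<le> s" for b
  proof -
    have i: "x + a *\<^sub>R v + b *\<^sub>R w \<in> D" using box a b by simp
    have l: "linear (Gv (x + a *\<^sub>R v + b *\<^sub>R w))" by (rule has_derivative_linear[OF Gv[OF i]])
    have "((\<lambda>b. x + a *\<^sub>R v + b *\<^sub>R w) has_derivative (\<lambda>t. t *\<^sub>R w)) (at b)"
      by (auto intro!: derivative_eq_intros)
    from has_derivative_compose[OF this Gv[OF i]]
    show ?thesis unfolding has_field_derivative_def
      using linear_scale[OF l] by (simp add: mult_commute_abs)
  qed
  obtain b where b: "0 < b" "b < s"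
    "G (x + a *\<^sub>R v + s *\<^sub>R w) v - G (x + a *\<^sub>R v + 0 *\<^sub>R w) v = (s - 0) * Gv (x + a *\<^sub>R v + b *\<^sub>R w) w"
    using MVT2[OF s, of "\<lambda>b. G (x + a *\<^sub>R v + b *\<^sub>R w) v" "\<lambda>b. Gv (x + a *\<^sub>R v + b *\<^sub>R w) w"] dq by blast
  show thesis
    using a b by (intro that[of a b]) (simp_all add: p_def algebra_simps)
qed

text \<open>Both orders of differentiation represent the same double difference, so a value of
  \<open>Gv _ w\<close> equals a value of \<open>Gw _ v\<close> inside an arbitrarily small
  parallelogram; continuity carries the equality to \<open>x\<close>. It serves twice, for the
  Hessian and for the third derivative.\<close>

lemma second_derivative_symmetric:
  fixes g :: "'a::real_normed_vector \<Rightarrow> real"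
  assumes D: "open D" "x \<in> D"
    and g: "\<And>y. y \<in> D \<Longrightarrow> (g has_derivative G y) (at y)"
    and Gv: "\<And>y. y \<in> D \<Longrightarrow> ((\<lambda>y. G y v) has_derivative Gv y) (at y)"
    and Gw: "\<And>y. y \<in> D \<Longrightarrow> ((\<lambda>y. G y w) has_derivative Gw y) (at y)"
    and cv: "continuous_on D (\<lambda>y. Gv y w)" and cw: "continuous_on D (\<lambda>y. Gw y v)"
  shows "Gv x w = Gw x v"
proof (rule ccontr)
  assume ne: "Gv x w \<noteq> Gw x v"
  define e where "e = \<bar>Gv x w - Gw x v\<bar> / 2"
  have e: "e > 0" using ne by (simp add: e_def)
  obtain d1 where d1: "d1 > 0" "ball x d1 \<subseteq> D" using D open_contains_ball by blast
  obtain d2 where d2: "d2 > 0" "\<And>y. y \<in> D \<Longrightarrow> dist y x < d2 \<Longrightarrow> dist (Gv y w) (Gv x w) < e"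
    using cv D e unfolding continuous_on_iff by blast
  obtain d3 where d3: "d3 > 0" "\<And>y. y \<in> D \<Longrightarrow> dist y x < d3 \<Longrightarrow> dist (Gw y v) (Gw x v) < e"
    using cw D e unfolding continuous_on_iff by blast
  define d where "d = min d1 (min d2 d3)"
  have d: "d > 0" using d1 d2 d3 by (simp add: d_def)
  \<comment> \<open>With this side the parallelogram stays within distance \<open>d / 2\<close> of
    \<open>x\<close>; the summand 1 keeps the denominator positive when both vectors vanish.\<close>
  define s where "s = d / (2 * (norm v + norm w + 1))"
  have pos: "norm v + norm w + 1 > 0" by (smt (verit) norm_ge_zero)
  have s: "s > 0" using d pos by (simp add: s_def)
  have sd: "s * (norm v + norm w) < d"
  proof -
    have "s * (norm v + norm w) \<le> s * (norm v + norm w + 1)" using s by (simp add: algebra_simps)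
    also have "\<dots> = d / 2" using pos unfolding s_def by (simp add: field_simps del: distrib_left_numeral)
    finally show ?thesis using d by simp
  qed
  have near: "dist (x + a *\<^sub>R v + b *\<^sub>R w) x < d" if "0 \<le> a" "a \<le> s" "0 \<le> b" "b \<le> s" for a b
  proof -
    have "dist (x + a *\<^sub>R v + b *\<^sub>R w) x = norm (a *\<^sub>R v + b *\<^sub>R w)"
      by (simp add: dist_norm algebra_simps)
    also have "\<dots> \<le> a * norm v + b * norm w"
      using that by (intro order_trans[OF norm_triangle_ineq]) simp
    also have "\<dots> \<le> s * norm v + s * norm w"
      using that by (intro add_mono mult_right_mono) auto
    finally show ?thesis using sd by (simp add: algebra_simps)
  qed
  have box: "x + a *\<^sub>R v + b *\<^sub>R w \<in> D" if "0 \<le> a" "a \<le> s" "0 \<le> b" "b \<le> s" for a b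
    using near[OF that] d1 by (auto simp: d_def dist_commute subset_iff)
  have box': "x + a *\<^sub>R w + b *\<^sub>R v \<in> D" if "0 \<le> a" "a \<le> s" "0 \<le> b" "b \<le> s" for a b
    using box[of b a] that by (simp add: algebra_simps)
  obtain a b where ab: "0 < a" "a < s" "0 < b" "b < s"
    "g (x + s *\<^sub>R v + s *\<^sub>R w) - g (x + s *\<^sub>R v) - g (x + s *\<^sub>R w) + g x = s * s * Gv (x + a *\<^sub>R v + b *\<^sub>R w) w"
    using double_difference_mvt[OF s box g Gv] by blast
  obtain a' b' where ab': "0 < a'" "a' < s" "0 < b'" "b' < s"
    "g (x + s *\<^sub>R w + s *\<^sub>R v) - g (x + s *\<^sub>R w) - g (x + s *\<^sub>R v) + g x = s * s * Gw (x + a' *\<^sub>R w + b' *\<^sub>R v) v"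
    using double_difference_mvt[OF s box' g Gw] by blast
  have eq: "x + s *\<^sub>R w + s *\<^sub>R v = x + s *\<^sub>R v + s *\<^sub>R w" by (simp add: algebra_simps)
  have "s * s * Gv (x + a *\<^sub>R v + b *\<^sub>R w) w = s * s * Gw (x + a' *\<^sub>R w + b' *\<^sub>R v) v"
    using ab(5) ab'(5) unfolding eq by linarith
  hence same: "Gv (x + a *\<^sub>R v + b *\<^sub>R w) w = Gw (x + b' *\<^sub>R v + a' *\<^sub>R w) v"
    using s by (simp add: algebra_simps)
  have "dist (Gv (x + a *\<^sub>R v + b *\<^sub>R w) w) (Gv x w) < e"
    using near[of a b] box[of a b] ab d2 by (simp add: d_def)
  moreover have "dist (Gw (x + b' *\<^sub>R v + a' *\<^sub>R w) v) (Gw x v) < e"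
    using near[of b' a'] box[of b' a'] ab' d3 by (simp add: d_def)
  ultimately have "dist (Gv x w) (Gw x v) < e + e"
    using same dist_triangle3[of "Gv x w" "Gw x v" "Gv (x + a *\<^sub>R v + b *\<^sub>R w) w"] by simp
  thus False by (simp add: e_def dist_real_def)
qed

section \<open>Symmetric trilinear forms\<close>

text \<open>\<open>P\<close> is the binary cubic form with coefficients \<open>p, q, m, n\<close>. The points \<open>(c, s), (c1, s1), (c2, s2)\<close>
  are the complex cube roots of a unit vector \<open>v\<close>, and the right-hand side of the second identity is the
  polar value at \<open>((1,0), (1,0), v)\<close>: it is a convex combination of the diagonal values at the roots.\<close>

lemma cubic_interpolation:
  fixes c s r p q m n :: real
  assumes cs: "c\<^sup>2 + s\<^sup>2 = 1" and r: "r\<^sup>2 = 3"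
  defines "c1 \<equiv> - c / 2 - r * s / 2" and "s1 \<equiv> - s / 2 + r * c / 2"
    and "c2 \<equiv> - c / 2 + r * s / 2" and "s2 \<equiv> - s / 2 - r * c / 2"
    and "d \<equiv> \<lambda>x::real. ((4 * x\<^sup>2 - 1) / 3)\<^sup>2"
    and "P \<equiv> \<lambda>x y. x ^ 3 * p + 3 * x\<^sup>2 * y * q + 3 * x * y\<^sup>2 * m + y ^ 3 * n"
  shows "d c + d c1 + d c2 = 1"
    and "d c * P c s + d c1 * P c1 s1 + d c2 * P c2 s2 = (4 * c ^ 3 - 3 * c) * p + (3 * s - 4 * s ^ 3) * q"
    and "c1\<^sup>2 + s1\<^sup>2 = 1" "c2\<^sup>2 + s2\<^sup>2 = 1"
proof -
  have ss: "s * s = 1 - c * c" using cs by (simp add: power2_eq_square)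
  have r2: "r * r = 3" using r by (simp add: power2_eq_square)
  have "c1\<^sup>2 + s1\<^sup>2 = (c * c + s * s) * (1 + r * r) / 4"
    unfolding c1_def s1_def by (simp add: power2_eq_square field_simps)
  thus u1: "c1\<^sup>2 + s1\<^sup>2 = 1" using ss r2 by simp
  have "c2\<^sup>2 + s2\<^sup>2 = (c * c + s * s) * (1 + r * r) / 4"
    unfolding c2_def s2_def by (simp add: power2_eq_square field_simps)
  thus u2: "c2\<^sup>2 + s2\<^sup>2 = 1" using ss r2 by simp
  have sq1: "4 * c1\<^sup>2 - 1 = 2 * s * (s + r * c)" and sq2: "4 * c2\<^sup>2 - 1 = 2 * s * (s - r * c)"
  proof -
    have "4 * c1\<^sup>2 = c * c + 2 * r * c * s + (r * r) * (s * s)" "4 * c2\<^sup>2 = c * c - 2 * r * c * s + (r * r) * (s * s)"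
      unfolding c1_def c2_def by (simp_all add: power2_eq_square field_simps)
    thus "4 * c1\<^sup>2 - 1 = 2 * s * (s + r * c)" "4 * c2\<^sup>2 - 1 = 2 * s * (s - r * c)"
      unfolding r2 using ss by (simp_all add: algebra_simps)
  qed
  \<comment> \<open>If \<open>c\<close> is the cosine of an angle t with nonzero sine,
    \<open>d c\<close> is the square of sin 3t / (3 sin t). The three nodes share sin 3t, which up
    to sign is \<open>4 * s * s1 * s2\<close>, so each weight is a multiple of the squared sines at
    the other two nodes.\<close>
  have d0: "d c = 16 / 9 * s1\<^sup>2 * s2\<^sup>2"
  proof -
    have "4 * (s1 * s2) = (s * s) - (r * r) * (c * c)"
      unfolding s1_def s2_def by (simp add: field_simps)
    hence "4 * c\<^sup>2 - 1 = - 4 * (s1 * s2)" unfolding r2 ss by (simp add: power2_eq_square algebra_simps)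
    thus ?thesis unfolding d_def by (simp add: power_mult_distrib power_divide)
  qed
  have d1: "d c1 = 16 / 9 * s\<^sup>2 * s2\<^sup>2"
  proof -
    have "4 * c1\<^sup>2 - 1 = - 4 * (s * s2)" unfolding sq1 s2_def by (simp add: field_simps)
    thus ?thesis unfolding d_def by (simp add: power_mult_distrib power_divide)
  qed
  have d2: "d c2 = 16 / 9 * s\<^sup>2 * s1\<^sup>2"
  proof -
    have "4 * c2\<^sup>2 - 1 = - 4 * (s * s1)" unfolding sq2 s1_def by (simp add: field_simps)
    thus ?thesis unfolding d_def by (simp add: power_mult_distrib power_divide)
  qed
  \<comment> \<open>The squared sines complete each weight to the common factor
    \<open>s\<^sup>2 * s1\<^sup>2 * s2\<^sup>2\<close>, and the cosines of three equally spaced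
    angles sum to 0.\<close>
  have 3: "d c * (3 * c * s\<^sup>2) + d c1 * (3 * c1 * s1\<^sup>2) + d c2 * (3 * c2 * s2\<^sup>2) = 0"
  proof -
    have "d c * (3 * c * s\<^sup>2) + d c1 * (3 * c1 * s1\<^sup>2) + d c2 * (3 * c2 * s2\<^sup>2) =
        16 / 3 * (s\<^sup>2 * s1\<^sup>2 * s2\<^sup>2) * (c + c1 + c2)" unfolding d0 d1 d2 by (simp add: algebra_simps)
    thus ?thesis by (simp add: c1_def c2_def field_simps)
  qed
  have 4: "d c * s^3 + d c1 * s1^3 + d c2 * s2^3 = 0"
  proof -
    have "d c * s^3 + d c1 * s1^3 + d c2 * s2^3 = 16 / 9 * (s\<^sup>2 * s1\<^sup>2 * s2\<^sup>2) * (s + s1 + s2)"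
      unfolding d0 d1 d2 by (simp add: power3_eq_cube power2_eq_square algebra_simps)
    thus ?thesis by (simp add: s1_def s2_def field_simps)
  qed
  have D0: "9 * d c = (4 * (c * c) - 1)\<^sup>2" and D1: "9 * d c1 = 4 * (s * s) * (s * s + (r * r) * (c * c) + 2 * r * c * s)"
    and D2: "9 * d c2 = 4 * (s * s) * (s * s + (r * r) * (c * c) - 2 * r * c * s)"
    unfolding d_def sq1 sq2 by (simp_all add: power2_eq_square field_simps)
  have "9 * (d c + d c1 + d c2) = (4 * (c * c) - 1)\<^sup>2 + 8 * (s * s) * (s * s + (r * r) * (c * c))"
    using D0 D1 D2 by (simp add: algebra_simps)
  thus "d c + d c1 + d c2 = 1" unfolding r2 ss by (simp add: power2_eq_square algebra_simps)
  have c12: "c1 + c2 = - c" "c1 - c2 = - r * s" "s1 + s2 = - s" "s1 - s2 = r * c"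
    by (simp_all add: c1_def c2_def s1_def s2_def field_simps)
  have comb: "9 * (d c * x + d c1 * y + d c2 * z) = (4 * (c * c) - 1)\<^sup>2 * x
      + 4 * (s * s) * ((s * s + (r * r) * (c * c)) * (y + z) + 2 * r * c * s * (y - z))" for x y z
  proof -
    have "9 * (d c * x + d c1 * y + d c2 * z) = (9 * d c) * x + (9 * d c1) * y + (9 * d c2) * z" by simp
    thus ?thesis unfolding D0 D1 D2 by (simp add: algebra_simps)
  qed
  have lin_c: "d c * c + d c1 * c1 + d c2 * c2 = 4 * c^3 - 3 * c"
  proof -
    have "9 * (d c * c + d c1 * c1 + d c2 * c2) =
        (4 * (c * c) - 1)\<^sup>2 * c - 4 * (s * s) * ((s * s + (r * r) * (c * c)) * c + 2 * (r * r) * c * (s * s))"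
      unfolding comb c12 by (simp add: algebra_simps)
    also have "\<dots> = 9 * (4 * c^3 - 3 * c)"
      unfolding r2 ss by (simp add: power2_eq_square power3_eq_cube algebra_simps)
    finally show ?thesis by simp
  qed
  have lin_s: "3 * (d c * s + d c1 * s1 + d c2 * s2) = 3 * s - 4 * s^3"
  proof -
    have "9 * (d c * s + d c1 * s1 + d c2 * s2) =
        s * ((4 * (c * c) - 1)\<^sup>2 + 4 * (s * s) * (2 * (r * r) * (c * c) - (s * s + (r * r) * (c * c))))"
      unfolding comb c12 by (simp add: algebra_simps)
    also have "\<dots> = s * (12 * (c * c) - 3)"
      unfolding r2 ss by (simp add: power2_eq_square algebra_simps)
    also have "\<dots> = 3 * (3 * s - 4 * (s * (s * s)))" unfolding ss by (simp add: algebra_simps)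
    finally show ?thesis by (simp add: power3_eq_cube)
  qed
  have circ: "c\<^sup>2 = 1 - s\<^sup>2" "c1\<^sup>2 = 1 - s1\<^sup>2" "c2\<^sup>2 = 1 - s2\<^sup>2"
    using cs u1 u2 by simp_all
  have cube: "x ^ 3 = x * (1 - y\<^sup>2)" if "x\<^sup>2 = 1 - y\<^sup>2" for x y :: real
    using that by (simp add: power3_eq_cube power2_eq_square)
  \<comment> \<open>On the unit circle the cubic moments reduce to the linear ones and to the
    vanishing sums \<open>3\<close> and \<open>4\<close>.\<close>
  have 1: "d c * c^3 + d c1 * c1^3 + d c2 * c2^3 = 4 * c^3 - 3 * c"
    using 3 lin_c unfolding cube[OF circ(1)] cube[OF circ(2)] cube[OF circ(3)] by (simp add: algebra_simps)
  have 2: "d c * (3 * c\<^sup>2 * s) + d c1 * (3 * c1\<^sup>2 * s1) + d c2 * (3 * c2\<^sup>2 * s2) = 3 * s - 4 * s^3"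
    using 4 lin_s unfolding circ by (simp add: power3_eq_cube power2_eq_square algebra_simps)
  have "d c * P c s + d c1 * P c1 s1 + d c2 * P c2 s2 =
     (d c * c^3 + d c1 * c1^3 + d c2 * c2^3) * p + (d c * (3 * c\<^sup>2 * s) + d c1 * (3 * c1\<^sup>2 * s1) + d c2 * (3 * c2\<^sup>2 * s2)) * q
     + (d c * (3 * c * s\<^sup>2) + d c1 * (3 * c1 * s1\<^sup>2) + d c2 * (3 * c2 * s2\<^sup>2)) * m + (d c * s^3 + d c1 * s1^3 + d c2 * s2^3) * n"
    unfolding P_def by (simp add: algebra_simps)
  thus "d c * P c s + d c1 * P c1 s1 + d c2 * P c2 s2 = (4 * c ^ 3 - 3 * c) * p + (3 * s - 4 * s ^ 3) * q"
    unfolding 1 2 3 4 by simp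
qed

section \<open>Cauchy-Schwarz and the seminorm of a positive semidefinite form\<close>

locale bilinear_inner =
  fixes B :: "'a::real_vector \<Rightarrow> 'a \<Rightarrow> real"
  assumes linear_right: "linear (B x)" and sym: "B x y = B y x"
    and nonneg: "0 \<le> B x x"
begin

lemma linear_left: "linear (\<lambda>x. B x y)"
  using linear_right[of y] by (simp add: sym[of _ y])

lemma add_right: "B x (y + z) = B x y + B x z" by (rule linear_add[OF linear_right])
lemma diff_right: "B x (y - z) = B x y - B x z" by (rule linear_diff[OF linear_right])
lemma scale_right: "B x (r *\<^sub>R y) = r * B x y" using linear_scale[OF linear_right] by simp
lemma add_left: "B (x + y) z = B x z + B y z" by (rule linear_add[OF linear_left])
lemma diff_left: "B (x - y) z = B x z - B y z" by (rule linear_diff[OF linear_left])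
lemma scale_left: "B (r *\<^sub>R x) z = r * B x z" using linear_scale[OF linear_left] by simp

lemmas expand = add_right diff_right scale_right add_left diff_left scale_left

definition nrm :: "'a \<Rightarrow> real" where "nrm x = sqrt (B x x)"

lemma nrm_nonneg: "0 \<le> nrm x" by (simp add: nrm_def nonneg)

lemma nrm_power2: "(nrm x)\<^sup>2 = B x x" by (simp add: nrm_def nonneg)

lemma cauchy_schwarz: "B x y \<le> nrm x * nrm y"
proof -
  have quad: "0 \<le> B x x - 2 * t * B x y + t\<^sup>2 * B y y" for t
    using nonneg[of "x - t *\<^sub>R y"] by (simp add: expand sym[of y x] power2_eq_square algebra_simps)
  have "(B x y)\<^sup>2 \<le> B x x * B y y"
  proof (cases "B y y = 0")
    case True
    \<comment> \<open>The quadratic in \<open>t\<close> degenerates to an affine function; the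
      \<open>t\<close> chosen below makes its value -1.\<close>
    have "B x y = 0"
    proof (rule ccontr)
      assume "B x y \<noteq> 0"
      thus False using quad[of "(B x x + 1) / (2 * B x y)"] True by simp
    qed
    thus ?thesis using True by simp
  next
    case False
    hence p: "B y y > 0" using nonneg[of y] by simp
    have "0 \<le> B x x - (B x y)\<^sup>2 / B y y"
      using quad[of "B x y / B y y"] p by (simp add: power2_eq_square field_simps)
    thus ?thesis using p by (simp add: field_simps)
  qed
  hence "(B x y)\<^sup>2 \<le> (nrm x * nrm y)\<^sup>2" by (simp add: power_mult_distrib nrm_power2)
  thus ?thesis by (meson abs_le_square_iff abs_ge_self nrm_nonneg mult_nonneg_nonneg abs_of_nonneg order_trans power2_le_imp_le real_le_rsqrt)
qed

lemma nrm_triangle: "nrm (x + y) \<le> nrm x + nrm y"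
proof (rule power2_le_imp_le)
  show "(nrm (x + y))\<^sup>2 \<le> (nrm x + nrm y)\<^sup>2"
    using cauchy_schwarz[of x y] by (simp add: power2_sum nrm_power2 expand sym[of y x])
qed (simp add: nrm_nonneg)

lemma nrm_scale: "nrm (r *\<^sub>R x) = \<bar>r\<bar> * nrm x"
  by (simp add: nrm_def expand real_sqrt_mult flip: mult.assoc)

lemma normalized:
  assumes "0 < nrm x"
  shows "B ((1 / nrm x) *\<^sub>R x) ((1 / nrm x) *\<^sub>R x) = 1"
proof -
  have "B ((1 / nrm x) *\<^sub>R x) ((1 / nrm x) *\<^sub>R x) = (nrm x)\<^sup>2 / (nrm x * nrm x)"
    unfolding nrm_power2 by (simp add: expand)
  thus ?thesis using assms by (simp add: power2_eq_square)
qed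

end

locale bounded_cubic = bilinear_inner B for B :: "'a::real_vector \<Rightarrow> 'a \<Rightarrow> real" +
  fixes A :: "'a \<Rightarrow> 'a \<Rightarrow> 'a \<Rightarrow> real" and c :: real
  assumes pos: "x \<noteq> 0 \<Longrightarrow> 0 < B x x"
    and A_linear: "linear (A x y)" and A_swap: "A x y z = A y x z" "A x y z = A x z y"
    and diag: "\<bar>A x x x\<bar> \<le> c * nrm x ^ 3"
begin

lemma A_linear2: "linear (\<lambda>y. A x y z)"
  using A_linear[of x z] by (simp add: A_swap(2)[of x _ z])

lemma A_linear1: "linear (\<lambda>x. A x y z)"
  using A_linear2[of y z] by (simp add: A_swap(1)[of _ y])

lemmas A_expand = linear_add[OF A_linear] linear_add[OF A_linear2] linear_add[OF A_linear1]
lemmas A_scale = linear_scale[OF A_linear] linear_scale[OF A_linear2] linear_scale[OF A_linear1]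

lemma A_diag_comb:
  "A (a *\<^sub>R e + b *\<^sub>R h) (a *\<^sub>R e + b *\<^sub>R h) (a *\<^sub>R e + b *\<^sub>R h) =
    a ^ 3 * A e e e + 3 * a\<^sup>2 * b * A e e h + 3 * a * b\<^sup>2 * A e h h + b ^ 3 * A h h h"
proof -
  have "A e h e = A e e h" "A h e e = A e e h" "A h e h = A e h h" "A h h e = A e h h"
    using A_swap by metis+
  thus ?thesis
    by (simp add: A_expand A_scale power2_eq_square power3_eq_cube algebra_simps)
qed

text \<open>By \<open>cubic_interpolation\<close> the value at the angle \<open>3 * \<theta>\<close>
  is a convex combination of the diagonal values at \<theta> and at \<theta> plus or minus 2 pi / 3,
  each bounded by \<open>c\<close> on the unit circle. The factor 3 avoids taking cube roots of a
  vector.\<close>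

lemma orthonormal_bound:
  assumes e: "B e e = 1" "B h h = 1" "B e h = 0"
  shows "\<bar>A e e (cos (3 * \<theta>) *\<^sub>R e + sin (3 * \<theta>) *\<^sub>R h)\<bar> \<le> c"
proof -
  define P where "P x y = x ^ 3 * A e e e + 3 * x\<^sup>2 * y * A e e h + 3 * x * y\<^sup>2 * A e h h + y ^ 3 * A h h h"
    for x y
  have bound: "\<bar>P x y\<bar> \<le> c" if "x\<^sup>2 + y\<^sup>2 = 1" for x y
  proof -
    have "B (x *\<^sub>R e + y *\<^sub>R h) (x *\<^sub>R e + y *\<^sub>R h) = 1"
      using e that by (simp add: expand sym[of h e] power2_eq_square)
    hence "nrm (x *\<^sub>R e + y *\<^sub>R h) = 1" by (simp add: nrm_def)
    thus ?thesis using diag[of "x *\<^sub>R e + y *\<^sub>R h"] by (simp add: A_diag_comb P_def)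
  qed
  define d where "d x = ((4 * x\<^sup>2 - 1) / 3)\<^sup>2" for x :: real
  have d0: "d x \<ge> 0" for x by (simp add: d_def)
  let ?c = "cos \<theta>" and ?s = "sin \<theta>" and ?r = "sqrt 3"
  have cs: "?c\<^sup>2 + ?s\<^sup>2 = 1" and r: "?r\<^sup>2 = 3" by simp_all
  note I = cubic_interpolation(1,3,4)[OF cs r, folded d_def]
  note I2 = cubic_interpolation(2)[OF cs r, of "A e e e" "A e e h" "A e h h" "A h h h", folded d_def P_def]
  let ?c1 = "- ?c / 2 - ?r * ?s / 2" and ?s1 = "- ?s / 2 + ?r * ?c / 2"
  let ?c2 = "- ?c / 2 + ?r * ?s / 2" and ?s2 = "- ?s / 2 - ?r * ?c / 2"
  have "cos (3 * \<theta>) = 4 * ?c ^ 3 - 3 * ?c" by (rule cos_treble_cos)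
  moreover have "sin (3 * \<theta>) = 3 * ?s - 4 * ?s ^ 3"
  proof -
    have "sin (3 * \<theta>) = sin (2 * \<theta> + \<theta>)" by simp
    also have "\<dots> = 2 * ?s * ?c\<^sup>2 + (1 - 2 * ?s\<^sup>2) * ?s"
      unfolding sin_add sin_double cos_double_sin by (simp add: power2_eq_square)
    also have "?c\<^sup>2 = 1 - ?s\<^sup>2" using cs by linarith
    finally show ?thesis by (simp add: power2_eq_square power3_eq_cube algebra_simps)
  qed
  ultimately have eq: "A e e (cos (3 * \<theta>) *\<^sub>R e + sin (3 * \<theta>) *\<^sub>R h) =
      d ?c * P ?c ?s + d ?c1 * P ?c1 ?s1 + d ?c2 * P ?c2 ?s2"
    unfolding I2 by (simp add: A_expand A_scale)
  have *: "\<bar>d x * P x y\<bar> \<le> d x * c" if "x\<^sup>2 + y\<^sup>2 = 1" for x y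
    using mult_left_mono[OF bound[OF that] d0[of x]] d0[of x] by (simp add: abs_mult)
  have "d ?c * c + d ?c1 * c + d ?c2 * c = c" using I(1) by (simp flip: distrib_right)
  thus ?thesis unfolding eq using *[OF cs] *[OF I(2)] *[OF I(3)] by linarith
qed

text \<open>Banach's theorem on symmetric multilinear forms, in degree three.\<close>

lemma polar_bound: "\<bar>A u u v\<bar> \<le> c * B u u * nrm v"
proof (cases "u = 0 \<or> v = 0")
  case True
  thus ?thesis using linear_0[OF A_linear] linear_0[OF A_linear1] linear_0[OF linear_right]
    by (auto simp: nrm_def)
next
  case False
  hence Bu: "B u u > 0" and Bv: "B v v > 0" using pos by auto
  hence nu: "nrm u > 0" and nv: "nrm v > 0" by (simp_all add: nrm_def)
  define e where "e = (1 / nrm u) *\<^sub>R u"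
  have ue: "u = nrm u *\<^sub>R e" using nu by (simp add: e_def)
  have ee: "B e e = 1" unfolding e_def by (rule normalized[OF nu])
  define v1 where "v1 = (1 / nrm v) *\<^sub>R v"
  have vv: "v = nrm v *\<^sub>R v1" using nv by (simp add: v1_def)
  have v1: "B v1 v1 = 1" unfolding v1_def by (rule normalized[OF nv])
  \<comment> \<open>Gram-Schmidt: by homogeneity the claim concerns unit vectors in the plane
    spanned by \<open>u\<close> and \<open>v\<close>. If \<open>w = 0\<close> the diagonal bound
    suffices; otherwise \<open>e\<close> and \<open>h\<close> form an orthonormal pair.\<close>
  define a where "a = B e v1"
  define w where "w = v1 - a *\<^sub>R e"
  have ew: "B e w = 0" by (simp add: w_def expand a_def ee)
  have ww: "B w w = 1 - a\<^sup>2"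
    using ew by (simp add: w_def expand a_def ee v1 sym[of v1 e] power2_eq_square algebra_simps)
  have key: "\<bar>A e e v1\<bar> \<le> c"
  proof (cases "w = 0")
    case True
    hence v1e: "v1 = a *\<^sub>R e" by (simp add: w_def)
    have "a\<^sup>2 = 1" using ww True linear_0[OF linear_right] by simp
    hence "\<bar>a\<bar> = 1" by (metis abs_1 power2_eq_1_iff abs_minus_cancel)
    moreover have "\<bar>A e e e\<bar> \<le> c" using diag[of e] by (simp add: nrm_def ee)
    ultimately show ?thesis by (simp add: v1e A_scale abs_mult)
  next
    case False
    hence Bw: "B w w > 0" using pos by auto
    define b where "b = nrm w"
    have b: "b > 0" using Bw by (simp add: b_def nrm_def)
    define h where "h = (1 / b) *\<^sub>R w"
    have hh: "B h h = 1" using normalized[of w] b unfolding h_def b_def by simp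
    have eh: "B e h = 0" by (simp add: h_def expand ew)
    have v1': "v1 = a *\<^sub>R e + b *\<^sub>R h" using b by (simp add: h_def w_def)
    have "a\<^sup>2 + b\<^sup>2 = 1" using ww by (simp add: b_def nrm_power2)
    then obtain t where "a = cos t" "b = sin t" using sincos_total_2pi[of a b] by metis
    thus ?thesis using orthonormal_bound[OF ee hh eh, of "t / 3"] by (simp add: v1')
  qed
  have "A u u v = (nrm u)\<^sup>2 * nrm v * A e e v1"
    by (subst ue, subst (2) ue, subst vv) (simp add: A_scale power2_eq_square)
  hence "\<bar>A u u v\<bar> = B u u * nrm v * \<bar>A e e v1\<bar>" using nv Bu by (simp add: abs_mult nrm_power2)
  also have "\<dots> \<le> B u u * nrm v * c" using key nv Bu by (intro mult_left_mono) auto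
  finally show ?thesis by (simp add: mult_ac)
qed

end

section \<open>Derivatives of self-concordant functions\<close>

locale nondegenerate_sc =
  fixes f :: "real^'n \<Rightarrow> ereal"
  assumes f_proper: "proper_fun f" and f_closed: "closed_fun f" and f_convex: "convex_fun f"
    and D_open: "open (effdom f)" and f_C3: "C_on 3 (real_part f) (effdom f)"
    and f_sc: "std_self_concordant f"
    and f_nondeg: "x \<in> effdom f \<Longrightarrow> invertible (hess f x)"
begin

abbreviation D where "D \<equiv> effdom f"
abbreviation F where "F \<equiv> real_part f"

definition H where "H x v w = v \<bullet> (hess f x *v w)"

definition T where "T x v w h = frechet_derivative (\<lambda>y. H y v w) (at x) h"

lemma f_eq_F: "x \<in> D \<Longrightarrow> f x = ereal (F x)"
  using f_proper by (cases "f x") (auto simp: effdom_def proper_fun_def real_part_def)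

lemma differentiability:
  shows "x \<in> D \<Longrightarrow> F differentiable (at x)"
    and "x \<in> D \<Longrightarrow> (\<lambda>x. frechet_derivative F (at x) v) differentiable (at x)"
    and "x \<in> D \<Longrightarrow> (\<lambda>x. frechet_derivative (\<lambda>x. frechet_derivative F (at x) v) (at x) w) differentiable (at x)"
    and "continuous_on D (\<lambda>x. frechet_derivative (\<lambda>x. frechet_derivative
           (\<lambda>x. frechet_derivative F (at x) v) (at x) w) (at x) h)"
  using f_C3 by (simp_all add: numeral_3_eq_3)

text \<open>The gradient is the Riesz representative of the derivative. Its explicit form as a sum
  over the basis lets the differentiability of directional derivatives pass to
  \<open>grad f\<close>.\<close>

lemma inner_grad:
  assumes "x \<in> D" shows "v \<bullet> grad f x = frechet_derivative F (at x) v"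
    and "grad f x = (\<Sum>b\<in>Basis. frechet_derivative F (at x) b *\<^sub>R b)"
    and "(F has_derivative (\<lambda>h. h \<bullet> grad f x)) (at x)"
proof -
  have d: "(F has_derivative frechet_derivative F (at x)) (at x)"
    using differentiability(1)[OF assms] frechet_derivative_works by blast
  have l: "linear (frechet_derivative F (at x))" using d has_derivative_linear by blast
  define g where "g = (\<Sum>b\<in>Basis. frechet_derivative F (at x) b *\<^sub>R b)"
  have g: "frechet_derivative F (at x) h = h \<bullet> g" for h
  proof -
    have "frechet_derivative F (at x) (\<Sum>b\<in>Basis. (h \<bullet> b) *\<^sub>R b) = h \<bullet> g"
      unfolding linear_sum[OF l] linear_scale[OF l] g_def inner_sum_right by (simp add: mult.commute)
    thus ?thesis by (simp add: euclidean_representation)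
  qed
  have gd: "GDERIV F x :> g" unfolding gderiv_def using d g by (metis (no_types, lifting) ext)
  have eq: "grad f x = g" unfolding grad_def
  proof (rule the_equality)
    show "GDERIV F x :> g" by (rule gd)
    fix k assume "GDERIV F x :> k"
    hence "(\<lambda>h. h \<bullet> k) = (\<lambda>h. h \<bullet> g)" using gd has_derivative_unique unfolding gderiv_def by blast
    thus "k = g" by (metis vector_eq_ldot)
  qed
  show "v \<bullet> grad f x = frechet_derivative F (at x) v" unfolding eq by (rule g[symmetric])
  show "grad f x = (\<Sum>b\<in>Basis. frechet_derivative F (at x) b *\<^sub>R b)" unfolding eq by (rule g_def)
  show "(F has_derivative (\<lambda>h. h \<bullet> grad f x)) (at x)" unfolding eq using gd by (simp add: gderiv_def)
qed

lemma grad_has_derivative: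
  assumes "x \<in> D" shows "(grad f has_derivative (\<lambda>h. hess f x *v h)) (at x)"
proof -
  have "(\<lambda>x. \<Sum>b\<in>Basis. frechet_derivative F (at x) b *\<^sub>R b) differentiable (at x)"
    using differentiability(2)[OF assms] by (intro differentiable_sum differentiable_scaleR differentiable_const) auto
  then obtain g' where "((\<lambda>x. \<Sum>b\<in>Basis. frechet_derivative F (at x) b *\<^sub>R b) has_derivative g') (at x)"
    unfolding differentiable_def by blast
  hence "(grad f has_derivative g') (at x)"
    by (rule has_derivative_transform_within_open[OF _ D_open assms]) (simp add: inner_grad(2))
  hence "grad f differentiable (at x)" unfolding differentiable_def by blast
  thus ?thesis unfolding hess_def using jacobian_works by blast
qed

lemma grad_dir_has_derivative:
  assumes "x \<in> D" shows "((\<lambda>y. v \<bullet> grad f y) has_derivative H x v) (at x)"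
  unfolding H_def by (rule has_derivative_inner_right[OF grad_has_derivative[OF assms]])

lemma H_eq:
  assumes "x \<in> D" shows "H x v w = frechet_derivative (\<lambda>x. frechet_derivative F (at x) v) (at x) w"
proof -
  have "((\<lambda>x. frechet_derivative F (at x) v) has_derivative H x v) (at x)"
    by (rule has_derivative_transform_within_open[OF grad_dir_has_derivative[OF assms] D_open assms])
      (simp add: inner_grad(1))
  from frechet_derivative_at[OF this] show ?thesis by simp
qed

lemma H_has_derivative:
  assumes "x \<in> D" shows "((\<lambda>y. H y v w) has_derivative T x v w) (at x)"
proof -
  obtain h' where "((\<lambda>x. frechet_derivative (\<lambda>x. frechet_derivative F (at x) v) (at x) w) has_derivative h') (at x)"
    using differentiability(3)[OF assms] unfolding differentiable_def by blast
  hence "((\<lambda>y. H y v w) has_derivative h') (at x)"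
    by (rule has_derivative_transform_within_open[OF _ D_open assms]) (simp add: H_eq)
  thus ?thesis unfolding T_def using frechet_derivative_at by metis
qed

lemma T_continuous: "continuous_on D (\<lambda>x. T x v w h)"
proof (subst continuous_on_cong[OF refl])
  fix x assume x: "x \<in> D"
  have "frechet_derivative (\<lambda>y. H y v w) (at x) =
      frechet_derivative (\<lambda>x. frechet_derivative (\<lambda>x. frechet_derivative F (at x) v) (at x) w) (at x)"
    by (rule frechet_derivative_transform_within_open[OF _ D_open x])
      (use H_has_derivative[OF x] in \<open>auto simp: differentiable_def H_eq\<close>)
  thus "T x v w h = frechet_derivative (\<lambda>x. frechet_derivative
           (\<lambda>x. frechet_derivative F (at x) v) (at x) w) (at x) h" by (simp add: T_def)
qed (rule differentiability(4))

lemma H_continuous: "continuous_on D (\<lambda>x. H x v w)"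
  by (intro continuous_at_imp_continuous_on ballI has_derivative_continuous[OF H_has_derivative])

lemma H_sym: "x \<in> D \<Longrightarrow> H x v w = H x w v"
  by (rule second_derivative_symmetric[where G = "\<lambda>y h. h \<bullet> grad f y", OF D_open _ inner_grad(3)
        grad_dir_has_derivative grad_dir_has_derivative H_continuous H_continuous])

text \<open>The first swap differentiates the symmetry of \<open>H\<close>; the second is the
  symmetry of the second derivative of \<open>\<lambda>y. v \<bullet> grad f y\<close>.\<close>

lemma T_swap:
  assumes "x \<in> D" shows "T x v w h = T x w v h" "T x v w h = T x v h w"
proof -
  have "((\<lambda>y. H y w v) has_derivative T x v w) (at x)"
    by (rule has_derivative_transform_within_open[OF H_has_derivative[OF assms] D_open assms]) (rule H_sym)
  thus "T x v w h = T x w v h" using has_derivative_unique H_has_derivative[OF assms] by metis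
  show "T x v w h = T x v h w"
    by (rule second_derivative_symmetric[where G = "\<lambda>y. H y v", OF D_open assms grad_dir_has_derivative
          H_has_derivative H_has_derivative T_continuous T_continuous])
qed

lemma line_derivs:
  assumes "x + t *\<^sub>R v \<in> D"
  shows F_line: "((\<lambda>t. F (x + t *\<^sub>R v)) has_real_derivative v \<bullet> grad f (x + t *\<^sub>R v)) (at t)"
    and grad_line: "((\<lambda>t. u \<bullet> grad f (x + t *\<^sub>R v)) has_real_derivative H (x + t *\<^sub>R v) u v) (at t)"
    and H_line: "((\<lambda>t. H (x + t *\<^sub>R v) u w) has_real_derivative T (x + t *\<^sub>R v) u w v) (at t)"
proof -
  have l: "((\<lambda>t. x + t *\<^sub>R v) has_derivative (\<lambda>t. t *\<^sub>R v)) (at t)"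
    by (auto intro!: derivative_eq_intros)
  have *: "((\<lambda>t. g (x + t *\<^sub>R v)) has_real_derivative g' v) (at t)"
    if g: "(g has_derivative g') (at (x + t *\<^sub>R v))" for g :: "real^'n \<Rightarrow> real" and g'
  proof -
    have "g' (s *\<^sub>R v) = s * g' v" for s using linear_scale[OF has_derivative_linear[OF g]] by simp
    thus ?thesis using has_derivative_compose[OF l g] by (simp add: has_field_derivative_def mult_commute_abs)
  qed
  show "((\<lambda>t. F (x + t *\<^sub>R v)) has_real_derivative v \<bullet> grad f (x + t *\<^sub>R v)) (at t)"
    by (rule *[OF inner_grad(3)[OF assms]])
  show "((\<lambda>t. u \<bullet> grad f (x + t *\<^sub>R v)) has_real_derivative H (x + t *\<^sub>R v) u v) (at t)"
    by (rule *[OF grad_dir_has_derivative[OF assms]])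
  show "((\<lambda>t. H (x + t *\<^sub>R v) u w) has_real_derivative T (x + t *\<^sub>R v) u w v) (at t)"
    by (rule *[OF H_has_derivative[OF assms]])
qed

lemma open_line: "open {t. x + t *\<^sub>R v \<in> D}"
proof -
  have "continuous_on UNIV (\<lambda>t::real. x + t *\<^sub>R v)" by (intro continuous_intros)
  from continuous_open_preimage[OF this open_UNIV D_open] show ?thesis by (simp add: vimage_def)
qed

text \<open>The hypothesis speaks of iterated \<open>deriv\<close> along a line. The lower
  derivatives are identified on the whole open set of admissible parameters, since they have to be
  differentiated again.\<close>

lemma sc_bound:
  assumes "x \<in> D" shows "\<bar>T x v v v\<bar> \<le> 2 * (H x v v) powr (3/2)"
proof -
  let ?\<phi> = "\<lambda>t. F (x + t *\<^sub>R v)" and ?U = "{t. x + t *\<^sub>R v \<in> D}"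
  have 1: "deriv ?\<phi> t = v \<bullet> grad f (x + t *\<^sub>R v)" if "t \<in> ?U" for t
    using DERIV_imp_deriv[OF F_line] that by simp
  have 2: "deriv (deriv ?\<phi>) t = H (x + t *\<^sub>R v) v v" if "t \<in> ?U" for t
    by (rule DERIV_imp_deriv[OF has_field_derivative_transform_within_open[OF grad_line open_line[of x v]]])
     (use that in \<open>auto simp: 1\<close>)
  have 0: "x + 0 *\<^sub>R v \<in> D" using assms by simp
  have 3: "deriv (deriv (deriv ?\<phi>)) 0 = T (x + 0 *\<^sub>R v) v v v"
    by (rule DERIV_imp_deriv[OF has_field_derivative_transform_within_open[OF H_line[OF 0] open_line[of x v]]])
     (use 0 in \<open>auto simp: 2\<close>)
  have "\<bar>(deriv ^^ 3) ?\<phi> 0\<bar> \<le> 2 * ((deriv ^^ 2) ?\<phi> 0) powr (3/2)"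
    using f_sc assms 0 unfolding std_self_concordant_def Let_def by blast
  thus ?thesis using 2[of 0] 3 0 by (simp add: numeral_3_eq_3 numeral_2_eq_2)
qed

section \<open>Convexity and positivity of the Hessian\<close>

lemma D_convex: "convex D"
proof (rule convexI)
  fix x y and u v :: real assume a: "x \<in> D" "y \<in> D" "0 \<le> u" "0 \<le> v" "u + v = 1"
  have "(x, F x) \<in> eepigraph f" "(y, F y) \<in> eepigraph f" using a by (auto simp: eepigraph_def f_eq_F)
  from convexD[OF f_convex[unfolded convex_fun_def] this a(3-5)]
  have "f (u *\<^sub>R x + v *\<^sub>R y) \<le> ereal (u * F x + v * F y)" by (simp add: eepigraph_def)
  thus "u *\<^sub>R x + v *\<^sub>R y \<in> D" by (auto simp: effdom_def)
qed

lemma F_convex: "convex_on D F"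
proof (rule convex_onI[OF _ D_convex])
  fix t x y assume a: "0 < t" "t < (1::real)" "x \<in> D" "y \<in> D"
  have "(x, F x) \<in> eepigraph f" "(y, F y) \<in> eepigraph f" using a by (auto simp: eepigraph_def f_eq_F)
  from convexD[OF f_convex[unfolded convex_fun_def] this, of "1 - t" t] a
  have *: "f ((1 - t) *\<^sub>R x + t *\<^sub>R y) \<le> ereal ((1 - t) * F x + t * F y)" by (simp add: eepigraph_def)
  have "(1 - t) *\<^sub>R x + t *\<^sub>R y \<in> D" using a by (intro convexD[OF D_convex]) auto
  thus "F ((1 - t) *\<^sub>R x + t *\<^sub>R y) \<le> (1 - t) * F x + t * F y" using * f_eq_F by simp
qed

lemma line_above_tangent:
  assumes "x + s *\<^sub>R v \<in> D" "x + t *\<^sub>R v \<in> D"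
  shows "(v \<bullet> grad f (x + s *\<^sub>R v)) * (t - s) \<le> F (x + t *\<^sub>R v) - F (x + s *\<^sub>R v)"
proof -
  let ?U = "{t. x + t *\<^sub>R v \<in> D}"
  have aff: "x + ((1 - r) * a + r * b) *\<^sub>R v = (1 - r) *\<^sub>R (x + a *\<^sub>R v) + r *\<^sub>R (x + b *\<^sub>R v)" for a b r
    by (simp add: algebra_simps)
  have U: "convex ?U"
    unfolding convex_alt using convexD_alt[OF D_convex] by (auto simp: aff)
  have "convex_on ?U (\<lambda>t. F (x + t *\<^sub>R v))"
    by (rule convex_onI[OF _ U]) (use convex_onD[OF F_convex] in \<open>auto simp: aff\<close>)
  thus ?thesis
    by (rule convex_on_imp_above_tangent[OF _ convex_connected[OF U]])
      (use assms open_line in \<open>auto simp: interior_open intro: has_field_derivative_at_within[OF F_line]\<close>)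
qed

lemma above_tangent:
  assumes "x \<in> D" "y \<in> D" shows "F x + (y - x) \<bullet> grad f x \<le> F y"
  using line_above_tangent[of x 0 "y - x" 1] assms by simp

text \<open>The tangent inequalities at two parameters, added, make the directional derivative
  monotone along a line, and \<open>H x v v\<close> is its derivative there.\<close>

lemma H_nonneg:
  assumes "x \<in> D" shows "0 \<le> H x v v"
proof -
  let ?U = "{t. x + t *\<^sub>R v \<in> D}"
  have "mono_on ?U (\<lambda>t. v \<bullet> grad f (x + t *\<^sub>R v))"
  proof (rule mono_onI)
    fix s t assume st: "s \<in> ?U" "t \<in> ?U" "s \<le> t"
    have "(v \<bullet> grad f (x + s *\<^sub>R v)) * (t - s) \<le> (v \<bullet> grad f (x + t *\<^sub>R v)) * (t - s)"
      using line_above_tangent[of x s v t] line_above_tangent[of x t v s] st by (simp add: algebra_simps)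
    thus "v \<bullet> grad f (x + s *\<^sub>R v) \<le> v \<bullet> grad f (x + t *\<^sub>R v)"
      using st by (cases "s = t") auto
  qed
  from mono_on_imp_deriv_nonneg[OF this grad_line, of 0] show ?thesis
    using assms open_line[of x v] by (simp add: interior_open)
qed

lemma H_inner: assumes x: "x \<in> D" shows "bilinear_inner (H x)"
proof (rule bilinear_inner.intro)
  show "linear (H x v)" for v
    by (rule linearI) (simp_all add: H_def matrix_vector_right_distrib inner_add_right matrix_vector_mult_scaleR)
qed (use x in \<open>auto intro: H_sym H_nonneg\<close>)

text \<open>For a semidefinite form Cauchy-Schwarz puts a vector of seminorm 0 into the kernel, and
  the kernel of an invertible Hessian is trivial.\<close>

lemma H_pos:
  assumes x: "x \<in> D" and v: "v \<noteq> 0" shows "0 < H x v v"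
proof (rule ccontr)
  interpret bilinear_inner "H x" by (rule H_inner[OF x])
  assume "\<not> 0 < H x v v"
  hence z: "nrm v = 0" using H_nonneg[OF x, of v] by (simp add: nrm_def)
  have "H x w v = 0" for w
    using cauchy_schwarz[of v w] cauchy_schwarz[of v "- w"] scale_right[of v "-1" w] z sym[of v w] by simp
  from this[of "hess f x *v v"] have "hess f x *v v = 0" by (simp add: H_def)
  hence "v = 0" using f_nondeg[OF x]
    by (metis invertible_def matrix_vector_mul_assoc matrix_vector_mul_lid matrix_vector_mult_0_right)
  thus False using v by simp
qed

lemma local_norm_eq: "x \<in> D \<Longrightarrow> local_norm f x v = bilinear_inner.nrm (H x) v"
  by (simp add: bilinear_inner.nrm_def[OF H_inner] local_norm_def H_def)

lemma H_cubic: "x \<in> D \<Longrightarrow> bounded_cubic (H x) (T x) 2"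
proof -
  assume x: "x \<in> D"
  interpret bilinear_inner "H x" by (rule H_inner[OF x])
  show ?thesis
  proof (intro bounded_cubic.intro bounded_cubic_axioms.intro H_inner[OF x])
    show "linear (T x v w)" for v w using H_has_derivative[OF x] has_derivative_linear by blast
    show "\<bar>T x v v v\<bar> \<le> 2 * nrm v ^ 3" for v
    proof -
      have "(H x v v) powr (3/2) = nrm v ^ 3"
      proof -
        have "nrm v ^ 3 = ((H x v v) powr (1/2)) ^ 3" by (simp add: nrm_def nonneg powr_half_sqrt)
        also have "\<dots> = (H x v v) powr (3/2)" by (cases "H x v v = 0") (simp_all add: powr_power)
        finally show ?thesis by simp
      qed
      thus ?thesis using sc_bound[OF x, of v] by simp
    qed
  qed (use x H_pos T_swap in auto)
qed

end

section \<open>Local geometry of self-concordant functions\<close>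

lemma self_concordant_growth:
  fixes g g' :: "real \<Rightarrow> real"
  assumes s: "0 \<le> s" and g: "\<And>t. 0 \<le> t \<Longrightarrow> t \<le> s \<Longrightarrow> (g has_real_derivative g' t) (at t)"
    and pos: "\<And>t. 0 \<le> t \<Longrightarrow> t \<le> s \<Longrightarrow> 0 < g t"
    and sc: "\<And>t. 0 \<le> t \<Longrightarrow> t \<le> s \<Longrightarrow> \<bar>g' t\<bar> \<le> 2 * sqrt (g t) ^ 3"
    and small: "s * sqrt (g 0) < 1"
  shows "sqrt (g s) \<le> sqrt (g 0) / (1 - s * sqrt (g 0))"
proof -
  \<comment> \<open>The derivative of \<open>1 / sqrt (g t)\<close> is
    \<open>- g' t / (2 * sqrt (g t) ^ 3)\<close>, which is at least -1 by \<open>sc\<close>.\<close>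
  have "1 / sqrt (g 0) + 0 \<le> 1 / sqrt (g s) + s"
  proof (rule DERIV_nonneg_imp_nondecreasing[OF s])
    fix t assume t: "0 \<le> t" "t \<le> s"
    let ?r = "sqrt (g t)"
    have r: "?r > 0" using pos[OF t] by simp
    have d: "((\<lambda>t. 1 / sqrt (g t) + t) has_real_derivative - (g' t / (2 * ?r)) / ?r\<^sup>2 + 1) (at t)"
      using g[OF t] pos[OF t] r by (auto intro!: derivative_eq_intros simp: power2_eq_square field_simps)
    have "g' t \<le> 2 * ?r ^ 3" using sc[OF t] by linarith
    hence "(g' t / (2 * ?r)) / ?r\<^sup>2 \<le> 1" using r by (simp add: field_simps power2_eq_square power3_eq_cube)
    thus "\<exists>y. ((\<lambda>t. 1 / sqrt (g t) + t) has_real_derivative y) (at t) \<and> 0 \<le> y" using d by force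
  qed
  moreover have "sqrt (g 0) > 0" "sqrt (g s) > 0" using pos s by auto
  ultimately show ?thesis using small by (simp add: field_simps)
qed

lemma has_derivative_reciprocal_affine:
  fixes a t :: real
  assumes "1 - t * a \<noteq> 0"
  shows "((\<lambda>t. 1 / (1 - t * a)) has_real_derivative a / (1 - t * a)\<^sup>2) (at t)"
    and "((\<lambda>t. 1 / (1 - t * a)\<^sup>2) has_real_derivative 2 * a / (1 - t * a) ^ 3) (at t)"
proof -
  have l: "((\<lambda>t. 1 - t * a) has_real_derivative - a) (at t)" by (auto intro!: derivative_eq_intros)
  have 1: "((\<lambda>q::real. 1 / q) has_real_derivative - 1 / q\<^sup>2) (at q)"
    and 2: "((\<lambda>q::real. 1 / q\<^sup>2) has_real_derivative - 2 / q ^ 3) (at q)" if "q \<noteq> 0" for q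
    using that by (auto intro!: derivative_eq_intros simp: power2_eq_square power3_eq_cube field_simps)
  show "((\<lambda>t. 1 / (1 - t * a)) has_real_derivative a / (1 - t * a)\<^sup>2) (at t)"
    using DERIV_chain2[OF 1[OF assms] l] by simp
  show "((\<lambda>t. 1 / (1 - t * a)\<^sup>2) has_real_derivative 2 * a / (1 - t * a) ^ 3) (at t)"
    using DERIV_chain2[OF 2[OF assms] l] by simp
qed

text \<open>A Gronwall argument: \<open>2 * a / (1 - t * a)\<close> is the logarithmic derivative of
  \<open>1 / (1 - t * a)\<^sup>2\<close>, so multiplying \<open>g t\<close> by
  \<open>(1 - t * a)\<^sup>2\<close> gives a nonincreasing function. The lower bound that follows
  divides by it instead.\<close>

lemma relative_growth_upper:
  fixes g g' :: "real \<Rightarrow> real"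
  assumes s: "0 \<le> s" and g: "\<And>t. 0 \<le> t \<Longrightarrow> t \<le> s \<Longrightarrow> (g has_real_derivative g' t) (at t)"
    and a: "0 \<le> a" "s * a < 1"
    and g': "\<And>t. 0 \<le> t \<Longrightarrow> t \<le> s \<Longrightarrow> g' t \<le> 2 * a / (1 - t * a) * g t"
  shows "g s \<le> g 0 / (1 - s * a)\<^sup>2"
proof -
  have "g s * (1 - s * a)\<^sup>2 \<le> g 0 * (1 - 0 * a)\<^sup>2"
  proof (rule DERIV_nonpos_imp_nonincreasing[OF s])
    fix t assume t: "0 \<le> t" "t \<le> s"
    have q: "1 - t * a > 0" using mult_right_mono[OF t(2) a(1)] a(2) by linarith
    have d: "((\<lambda>t. g t * (1 - t * a)\<^sup>2) has_real_derivative
        (1 - t * a) * (g' t * (1 - t * a) - 2 * a * g t)) (at t)"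
      using g[OF t] by (auto intro!: derivative_eq_intros simp: power2_eq_square algebra_simps)
    have "g' t * (1 - t * a) \<le> 2 * a * g t" using g'[OF t] q by (simp add: field_simps)
    hence "(1 - t * a) * (g' t * (1 - t * a) - 2 * a * g t) \<le> 0"
      using q by (intro mult_nonneg_nonpos) auto
    thus "\<exists>y. ((\<lambda>t. g t * (1 - t * a)\<^sup>2) has_real_derivative y) (at t) \<and> y \<le> 0" using d by blast
  qed
  thus ?thesis using a by (simp add: field_simps)
qed

lemma relative_growth_lower:
  fixes g g' :: "real \<Rightarrow> real"
  assumes s: "0 \<le> s" and g: "\<And>t. 0 \<le> t \<Longrightarrow> t \<le> s \<Longrightarrow> (g has_real_derivative g' t) (at t)"
    and a: "0 \<le> a" "s * a < 1"
    and g': "\<And>t. 0 \<le> t \<Longrightarrow> t \<le> s \<Longrightarrow> - (2 * a / (1 - t * a) * g t) \<le> g' t"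
  shows "(1 - s * a)\<^sup>2 * g 0 \<le> g s"
proof -
  have "g 0 / (1 - 0 * a)\<^sup>2 \<le> g s / (1 - s * a)\<^sup>2"
  proof (rule DERIV_nonneg_imp_nondecreasing[OF s])
    fix t assume t: "0 \<le> t" "t \<le> s"
    have q: "1 - t * a > 0" using mult_right_mono[OF t(2) a(1)] a(2) by linarith
    have "((\<lambda>t. g t * (1 / (1 - t * a)\<^sup>2)) has_real_derivative
        g' t * (1 / (1 - t * a)\<^sup>2) + 2 * a / (1 - t * a) ^ 3 * g t) (at t)"
      by (rule DERIV_mult[OF g[OF t] has_derivative_reciprocal_affine(2)]) (use q in auto)
    moreover have "g' t * (1 / (1 - t * a)\<^sup>2) + 2 * a / (1 - t * a) ^ 3 * g t =
        (g' t * (1 - t * a) + 2 * a * g t) / (1 - t * a) ^ 3"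
      using q by (simp add: add_divide_distrib power2_eq_square power3_eq_cube)
    ultimately have d: "((\<lambda>t. g t / (1 - t * a)\<^sup>2) has_real_derivative
        (g' t * (1 - t * a) + 2 * a * g t) / (1 - t * a) ^ 3) (at t)" by simp
    have "0 \<le> g' t * (1 - t * a) + 2 * a * g t" using g'[OF t] q by (simp add: field_simps)
    hence "0 \<le> (g' t * (1 - t * a) + 2 * a * g t) / (1 - t * a) ^ 3"
      using q by (intro divide_nonneg_pos) auto
    thus "\<exists>y. ((\<lambda>t. g t / (1 - t * a)\<^sup>2) has_real_derivative y) (at t) \<and> 0 \<le> y" using d by blast
  qed
  thus ?thesis using a by (simp add: field_simps)
qed

text \<open>Convexity of the inverse square between 1 and \<open>q\<close>, obtained from convexity
  of the reciprocal and of the square. In \<open>F_upper\<close> it replaces a Hessian bound whose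
  double integral is a logarithm by one that is affine in \<open>t\<close>.\<close>

lemma inverse_square_chord:
  fixes q t :: real
  assumes q: "0 < q" and t: "0 \<le> t" "t \<le> 1"
  shows "1 / ((1 - t) + t * q)\<^sup>2 \<le> (1 - t) + t / q\<^sup>2"
proof -
  define r where "r = 1 / q"
  have r: "r * q = 1" "r > 0" using q by (simp_all add: r_def)
  have p: "(1 - t) + t * q > 0" using q t
    by (cases "t = 0") (auto intro: add_nonneg_pos)
  have "0 \<le> (q - 1)\<^sup>2 * r" using r by simp
  hence "2 \<le> q + r" using r by (simp add: power2_eq_square algebra_simps)
  hence "t * (1 - t) * 2 \<le> t * (1 - t) * (q + r)" using t by (intro mult_left_mono) auto
  moreover have "((1 - t) + t * r) * ((1 - t) + t * q) = 1 - t * (1 - t) * 2 + t * (1 - t) * (q + r) + t * t * (r * q - 1)"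
    by (simp add: algebra_simps)
  ultimately have "1 \<le> ((1 - t) + t * r) * ((1 - t) + t * q)" using r(1) by simp
  hence "1 / ((1 - t) + t * q) \<le> (1 - t) + t * r" using p by (simp add: field_simps)
  hence "(1 / ((1 - t) + t * q))\<^sup>2 \<le> ((1 - t) + t * r)\<^sup>2" using p by (intro power_mono) auto
  also have "\<dots> \<le> (1 - t) + t * r\<^sup>2"
  proof -
    have "(1 - t) + t * r\<^sup>2 - ((1 - t) + t * r)\<^sup>2 = t * (1 - t) * (1 - r)\<^sup>2"
      by (simp add: power2_eq_square algebra_simps)
    also have "\<dots> \<ge> 0" using t by simp
    finally show ?thesis by simp
  qed
  finally show ?thesis by (simp add: r_def power_divide)
qed

section \<open>Comparison of Hessians, gradients and values along segments; the Dikin ball\<close>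

context nondegenerate_sc begin

abbreviation N where "N \<equiv> local_norm f"

lemma N_nonneg: "x \<in> D \<Longrightarrow> 0 \<le> N x v"
  by (simp add: local_norm_eq bilinear_inner.nrm_nonneg[OF H_inner])

lemma N_power2: "x \<in> D \<Longrightarrow> (N x v)\<^sup>2 = H x v v"
  by (simp add: local_norm_eq bilinear_inner.nrm_power2[OF H_inner])

lemma N_eq: "N x v = sqrt (H x v v)" by (simp add: local_norm_def H_def)

lemma T_bound: "x \<in> D \<Longrightarrow> \<bar>T x u u v\<bar> \<le> 2 * (N x u)\<^sup>2 * N x v"
  using bounded_cubic.polar_bound[OF H_cubic] by (simp add: local_norm_eq bilinear_inner.nrm_power2[OF H_inner])

lemma segment_in_D:
  assumes "x \<in> D" "x + s *\<^sub>R v \<in> D" "0 \<le> t" "t \<le> s" shows "x + t *\<^sub>R v \<in> D"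
proof (cases "s = 0")
  case False
  have "(1 - t / s) *\<^sub>R x + (t / s) *\<^sub>R (x + s *\<^sub>R v) \<in> D"
    using assms False by (intro convexD[OF D_convex]) (auto simp: field_simps)
  thus ?thesis using False by (simp add: algebra_simps)
qed (use assms in auto)

lemma N_growth:
  assumes x: "x \<in> D" and s: "x + s *\<^sub>R v \<in> D" "0 \<le> s" and small: "s * N x v < 1"
  shows "N (x + s *\<^sub>R v) v \<le> N x v / (1 - s * N x v)"
proof (cases "v = 0")
  case True
  thus ?thesis by (simp add: N_eq H_def)
next
  case False
  note i = segment_in_D[OF x s(1)]
  have "sqrt (H (x + s *\<^sub>R v) v v) \<le> sqrt (H (x + 0 *\<^sub>R v) v v) / (1 - s * sqrt (H (x + 0 *\<^sub>R v) v v))"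
  proof (rule self_concordant_growth[OF s(2) H_line[OF i]])
    fix t assume t: "0 \<le> t" "t \<le> s"
    show "0 < H (x + t *\<^sub>R v) v v" by (rule H_pos[OF i[OF t] False])
    show "\<bar>T (x + t *\<^sub>R v) v v v\<bar> \<le> 2 * sqrt (H (x + t *\<^sub>R v) v v) ^ 3"
      using T_bound[OF i[OF t], of v v] by (simp add: N_eq power2_eq_square power3_eq_cube mult.assoc)
  qed (use small in \<open>auto simp: N_eq\<close>)
  thus ?thesis by (simp add: N_eq)
qed

text \<open>\<open>T_bound\<close> is taken at the moving point; \<open>N_growth\<close> then
  expresses the length of \<open>v\<close> there through its length at \<open>x\<close>. This is the
  differential inequality required by the two growth lemmas.\<close>

lemma T_segment:
  assumes x: "x \<in> D" and t: "x + t *\<^sub>R v \<in> D" "0 \<le> t" "t * N x v < 1"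
  shows "\<bar>T (x + t *\<^sub>R v) u u v\<bar> \<le> 2 * N x v / (1 - t * N x v) * H (x + t *\<^sub>R v) u u"
proof -
  have "\<bar>T (x + t *\<^sub>R v) u u v\<bar> \<le> 2 * H (x + t *\<^sub>R v) u u * N (x + t *\<^sub>R v) v"
    using T_bound[OF t(1), of u v] by (simp add: N_power2[OF t(1)])
  also have "\<dots> \<le> 2 * H (x + t *\<^sub>R v) u u * (N x v / (1 - t * N x v))"
    by (intro mult_left_mono N_growth) (use x t H_nonneg in auto)
  finally show ?thesis by (simp add: mult_ac)
qed

lemma H_compare:
  assumes x: "x \<in> D" and s: "x + s *\<^sub>R v \<in> D" "0 \<le> s" and small: "s * N x v < 1"
  shows "H (x + s *\<^sub>R v) u u \<le> H x u u / (1 - s * N x v)\<^sup>2"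
    and "(1 - s * N x v)\<^sup>2 * H x u u \<le> H (x + s *\<^sub>R v) u u"
proof -
  note i = segment_in_D[OF x s(1)]
  have *: "t * N x v < 1" if "0 \<le> t" "t \<le> s" for t
    using mult_right_mono[OF that(2) N_nonneg[OF x, of v]] small by linarith
  have b: "\<bar>T (x + t *\<^sub>R v) u u v\<bar> \<le> 2 * N x v / (1 - t * N x v) * H (x + t *\<^sub>R v) u u"
    if "0 \<le> t" "t \<le> s" for t by (rule T_segment[OF x i[OF that] that(1) *[OF that]])
  have "H (x + s *\<^sub>R v) u u \<le> H (x + 0 *\<^sub>R v) u u / (1 - s * N x v)\<^sup>2"
    by (rule relative_growth_upper[OF s(2) H_line[OF i] N_nonneg[OF x] small])
      (use b in \<open>auto intro: order_trans[OF abs_ge_self]\<close>)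
  thus "H (x + s *\<^sub>R v) u u \<le> H x u u / (1 - s * N x v)\<^sup>2" by simp
  have "(1 - s * N x v)\<^sup>2 * H (x + 0 *\<^sub>R v) u u \<le> H (x + s *\<^sub>R v) u u"
    by (rule relative_growth_lower[OF s(2) H_line[OF i] N_nonneg[OF x] small])
      (use b in \<open>auto simp: abs_le_iff minus_le_iff\<close>)
  thus "(1 - s * N x v)\<^sup>2 * H x u u \<le> H (x + s *\<^sub>R v) u u" by simp
qed

lemma N_compare:
  assumes x: "x \<in> D" and s: "x + s *\<^sub>R v \<in> D" "0 \<le> s" and small: "s * N x v < 1"
  shows "N (x + s *\<^sub>R v) u \<le> N x u / (1 - s * N x v)"
    and "(1 - s * N x v) * N x u \<le> N (x + s *\<^sub>R v) u"
proof -
  have "sqrt (H (x + s *\<^sub>R v) u u) \<le> sqrt (H x u u / (1 - s * N x v)\<^sup>2)"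
    using H_compare(1)[OF assms] by simp
  thus "N (x + s *\<^sub>R v) u \<le> N x u / (1 - s * N x v)" using small by (simp add: N_eq real_sqrt_divide)
  have "sqrt ((1 - s * N x v)\<^sup>2 * H x u u) \<le> sqrt (H (x + s *\<^sub>R v) u u)"
    using H_compare(2)[OF assms] by simp
  thus "(1 - s * N x v) * N x u \<le> N (x + s *\<^sub>R v) u" using small by (simp add: N_eq real_sqrt_mult)
qed

text \<open>The bound is linear in \<open>N x u\<close>, hence a bound on the gradient error in the
  dual local norm. An estimate of the third derivative is integrated twice, each time by comparing
  derivatives.\<close>

lemma grad_remainder:
  assumes x: "x \<in> D" and xv: "x + v \<in> D" and small: "N x v < 1"
  shows "u \<bullet> grad f (x + v) - u \<bullet> grad f x - H x u v \<le> N x u * ((N x v)\<^sup>2 / (1 - N x v))"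
proof -
  define a where "a = N x v"
  define n where "n = N x u"
  have a: "0 \<le> a" "a < 1" using N_nonneg[OF x] small by (auto simp: a_def)
  have n: "0 \<le> n" using N_nonneg[OF x] by (simp add: n_def)
  have i: "x + t *\<^sub>R v \<in> D" if "0 \<le> t" "t \<le> 1" for t
    using segment_in_D[OF x, of 1 v t] xv that by simp
  have small': "t * a < 1" if "0 \<le> t" "t \<le> 1" for t
    using mult_right_mono[OF that(2) a(1)] a by linarith
  define j where "j t = H (x + t *\<^sub>R v) u v" for t
  have T: "T (x + t *\<^sub>R v) u v v \<le> 2 * a\<^sup>2 * n / (1 - t * a) ^ 3" if t: "0 \<le> t" "t \<le> 1" for t
  proof -
    have D: "x + t *\<^sub>R v \<in> D" by (rule i[OF t])
    have q: "1 - t * a > 0" using small'[OF t] by simp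
    \<comment> \<open>Symmetry puts \<open>v\<close> into the repeated slot of the polar bound, so
      that \<open>u\<close> enters only linearly.\<close>
    have "T (x + t *\<^sub>R v) u v v = T (x + t *\<^sub>R v) v v u" using T_swap[OF D] by metis
    also have "\<dots> \<le> 2 * (N (x + t *\<^sub>R v) v)\<^sup>2 * N (x + t *\<^sub>R v) u" using T_bound[OF D, of v u] by linarith
    also have "\<dots> \<le> 2 * (a / (1 - t * a))\<^sup>2 * (n / (1 - t * a))"
      using N_compare(1)[OF x D t(1)] small'[OF t] N_nonneg[OF D] a n q
      by (intro mult_mono power_mono) (auto simp: a_def n_def)
    finally show ?thesis by (simp add: power2_eq_square power3_eq_cube)
  qed
  have j: "j t \<le> j 0 + n * a * (1 / (1 - t * a)\<^sup>2 - 1)" if t: "0 \<le> t" "t \<le> 1" for t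
  proof -
    have "j t - n * a * (1 / (1 - t * a)\<^sup>2) \<le> j 0 - n * a * (1 / (1 - 0 * a)\<^sup>2)"
    proof (rule DERIV_nonpos_imp_nonincreasing[OF t(1)])
      fix r assume "0 \<le> r" "r \<le> t"
      hence r: "0 \<le> r" "r \<le> 1" using t by auto
      have q: "1 - r * a > 0" using small'[OF r] by simp
      have "((\<lambda>t. j t - n * a * (1 / (1 - t * a)\<^sup>2)) has_real_derivative
          T (x + r *\<^sub>R v) u v v - n * a * (2 * a / (1 - r * a) ^ 3)) (at r)"
        unfolding j_def
        by (rule DERIV_diff[OF H_line[OF i[OF r]] DERIV_cmult[OF has_derivative_reciprocal_affine(2)]]) (use q in auto)
      moreover have "n * a * (2 * a / (1 - r * a) ^ 3) = 2 * a\<^sup>2 * n / (1 - r * a) ^ 3" by (simp add: power2_eq_square)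
      ultimately have "((\<lambda>t. j t - n * a * (1 / (1 - t * a)\<^sup>2)) has_real_derivative
          T (x + r *\<^sub>R v) u v v - 2 * a\<^sup>2 * n / (1 - r * a) ^ 3) (at r)" by (simp only:)
      thus "\<exists>y. ((\<lambda>t. j t - n * a * (1 / (1 - t * a)\<^sup>2)) has_real_derivative y) (at r) \<and> y \<le> 0"
        using T[OF r] by force
    qed
    thus ?thesis by (simp add: algebra_simps)
  qed
  \<comment> \<open>Second integration: the subtracted function has the bound on \<open>j\<close> as
    its derivative, and between 0 and 1 it grows by
    \<open>j 0 + n * (1 / (1 - a) - a - 1)\<close>.\<close>
  let ?G = "\<lambda>t. u \<bullet> grad f (x + t *\<^sub>R v) - (j 0 * t + n * (1 / (1 - t * a) - t * a))"
  have "?G 1 \<le> ?G 0"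
  proof (rule DERIV_nonpos_imp_nonincreasing[of 0 1 ?G])
    fix t :: real assume t: "0 \<le> t" "t \<le> 1"
    have q: "1 - t * a > 0" using small'[OF t] by simp
    have "((\<lambda>t. j 0 * t + n * (1 / (1 - t * a) - t * a)) has_real_derivative
        j 0 + n * (a / (1 - t * a)\<^sup>2 - 1 * a)) (at t)"
      by (rule DERIV_add[OF DERIV_cmult_Id DERIV_cmult[OF DERIV_diff[OF has_derivative_reciprocal_affine(1)
              DERIV_cmult_right[OF DERIV_ident]]]]) (use q in auto)
    moreover have "n * (a / (1 - t * a)\<^sup>2 - 1 * a) = n * a * (1 / (1 - t * a)\<^sup>2 - 1)" by (simp add: algebra_simps)
    ultimately have "((\<lambda>t. j 0 * t + n * (1 / (1 - t * a) - t * a)) has_real_derivative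
        j 0 + n * a * (1 / (1 - t * a)\<^sup>2 - 1)) (at t)" by (simp only:)
    from DERIV_diff[OF grad_line[OF i[OF t]] this, of u]
    have "(?G has_real_derivative j t - (j 0 + n * a * (1 / (1 - t * a)\<^sup>2 - 1))) (at t)"
      by (simp only: j_def)
    thus "\<exists>y. (?G has_real_derivative y) (at t) \<and> y \<le> 0" using j[OF t] by force
  qed simp
  moreover have "1 / (1 - a) - a - 1 = a\<^sup>2 / (1 - a)" using a by (simp add: field_simps power2_eq_square)
  moreover have "n * (1 / (1 - a) - a) - n = n * (1 / (1 - a) - a - 1)" by (simp add: algebra_simps)
  ultimately show ?thesis by (simp add: j_def a_def n_def)
qed

text \<open>The curvature along the segment is bounded by the chord of
  \<open>a\<^sup>2 / (1 - t * a)\<^sup>2\<close> from \<open>t = 0\<close> to \<open>t = 1\<close>;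
  two integrations give \<open>a\<^sup>2 / 2 + c / 6\<close>, where \<open>c\<close> is the slope of
  the chord.\<close>

lemma F_upper:
  assumes x: "x \<in> D" and xv: "x + v \<in> D" and small: "N x v < 1"
  shows "F (x + v) \<le> F x + v \<bullet> grad f x + (N x v)\<^sup>2 / 2 + N x v ^ 3 * (2 - N x v) / (6 * (1 - N x v)\<^sup>2)"
proof -
  define a where "a = N x v"
  have a: "0 \<le> a" "a < 1" using N_nonneg[OF x] small by (auto simp: a_def)
  have i: "x + t *\<^sub>R v \<in> D" if "0 \<le> t" "t \<le> 1" for t
    using segment_in_D[OF x, of 1 v t] xv that by simp
  define c where "c = a\<^sup>2 * (1 / (1 - a)\<^sup>2 - 1)"
  have H: "H (x + t *\<^sub>R v) v v \<le> a\<^sup>2 + c * t" if t: "0 \<le> t" "t \<le> 1" for t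
  proof -
    have sm: "t * a < 1" using mult_right_mono[OF t(2) a(1)] a by linarith
    have "H (x + t *\<^sub>R v) v v \<le> H x v v / (1 - t * N x v)\<^sup>2"
      using H_compare(1)[OF x i[OF t] t(1)] sm by (simp add: a_def)
    also have "\<dots> = a\<^sup>2 * (1 / ((1 - t) + t * (1 - a))\<^sup>2)" by (simp add: a_def N_power2[OF x] algebra_simps)
    also have "\<dots> \<le> a\<^sup>2 * ((1 - t) + t / (1 - a)\<^sup>2)"
      using a t by (intro mult_left_mono inverse_square_chord) auto
    also have "\<dots> = a\<^sup>2 + c * t" by (simp add: c_def algebra_simps)
    finally show ?thesis .
  qed
  have g: "v \<bullet> grad f (x + t *\<^sub>R v) \<le> v \<bullet> grad f x + a\<^sup>2 * t + c * t\<^sup>2 / 2" if t: "0 \<le> t" "t \<le> 1" for t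
  proof -
    let ?G = "\<lambda>t. v \<bullet> grad f (x + t *\<^sub>R v) - (a\<^sup>2 * t + c * t\<^sup>2 / 2)"
    have "?G t \<le> ?G 0"
    proof (rule DERIV_nonpos_imp_nonincreasing[OF t(1), of ?G])
      fix r assume "0 \<le> r" "r \<le> t"
      hence r: "0 \<le> r" "r \<le> 1" using t by auto
      have "(?G has_real_derivative H (x + r *\<^sub>R v) v v - (a\<^sup>2 + c * r)) (at r)"
        by (rule DERIV_diff[OF grad_line[OF i[OF r]]]) (auto intro!: derivative_eq_intros)
      thus "\<exists>y. (?G has_real_derivative y) (at r) \<and> y \<le> 0" using H[OF r] by force
    qed
    thus ?thesis by simp
  qed
  let ?G = "\<lambda>t. F (x + t *\<^sub>R v) - (v \<bullet> grad f x * t + a\<^sup>2 * t\<^sup>2 / 2 + c * t ^ 3 / 6)"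
  have "?G 1 \<le> ?G 0"
  proof (rule DERIV_nonpos_imp_nonincreasing[of 0 1 ?G])
    fix t :: real assume t: "0 \<le> t" "t \<le> 1"
    have "(?G has_real_derivative v \<bullet> grad f (x + t *\<^sub>R v) - (v \<bullet> grad f x + a\<^sup>2 * t + c * t\<^sup>2 / 2)) (at t)"
      by (rule DERIV_diff[OF F_line[OF i[OF t]]]) (auto intro!: derivative_eq_intros)
    thus "\<exists>y. (?G has_real_derivative y) (at t) \<and> y \<le> 0" using g[OF t] by force
  qed simp
  moreover have "c = a ^ 3 * (2 - a) / (1 - a)\<^sup>2"
  proof -
    have "a ^ 3 * (2 - a) = a\<^sup>2 * (1 - (1 - a)\<^sup>2)" by (simp add: power2_eq_square power3_eq_cube algebra_simps)
    thus ?thesis using a by (simp add: c_def right_diff_distrib diff_divide_distrib)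
  qed
  ultimately show ?thesis by (simp add: a_def mult.commute)
qed

text \<open>Along a segment that stays in the local unit ball, \<open>f\<close> is bounded on the part inside the domain;
  closedness of the epigraph then makes that part relatively closed, hence the whole segment.\<close>

lemma dikin:
  assumes x: "x \<in> D" and small: "N x v < 1" shows "x + v \<in> D"
proof -
  define a where "a = N x v"
  have a: "0 \<le> a" "a < 1" using N_nonneg[OF x] small by (auto simp: a_def)
  \<comment> \<open>Two mean value steps of length at most 1 give this bound, the curvature on the
    admissible part being at most \<open>a\<^sup>2 / (1 - a)\<^sup>2\<close>. The absolute value
    allows the initial slope to be scaled by \<open>s \<le> 1\<close> whatever its sign.\<close>
  define M where "M = F x + \<bar>v \<bullet> grad f x\<bar> + a\<^sup>2 / (1 - a)\<^sup>2"
  have bound: "F (x + s *\<^sub>R v) \<le> M" if s: "0 \<le> s" "s \<le> 1" "x + s *\<^sub>R v \<in> D" for s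
  proof (cases "s = 0")
    case True
    thus ?thesis by (simp add: M_def)
  next
    case False
    hence s0: "0 < s" using s by simp
    note i = segment_in_D[OF x s(3)]
    obtain r where r: "0 < r" "r < s" "F (x + s *\<^sub>R v) - F (x + 0 *\<^sub>R v) = (s - 0) * (v \<bullet> grad f (x + r *\<^sub>R v))"
      using MVT2[OF s0 F_line[OF i]] by blast
    have i': "x + t *\<^sub>R v \<in> D" if "0 \<le> t" "t \<le> r" for t using i that r by simp
    obtain r' where r': "0 < r'" "r' < r"
      "v \<bullet> grad f (x + r *\<^sub>R v) - v \<bullet> grad f (x + 0 *\<^sub>R v) = (r - 0) * H (x + r' *\<^sub>R v) v v"
      using MVT2[OF r(1) grad_line[OF i']] by blast
    have D: "x + r' *\<^sub>R v \<in> D" using i r r' by simp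
    have "r' * a \<le> 1 * a" using r r' s a by (intro mult_right_mono) auto
    hence ra: "1 - a \<le> 1 - r' * a" by simp
    have "H (x + r' *\<^sub>R v) v v \<le> H x v v / (1 - r' * N x v)\<^sup>2"
      using ra a r' by (intro H_compare(1)[OF x D]) (auto simp: a_def)
    also have "\<dots> \<le> a\<^sup>2 / (1 - a)\<^sup>2" unfolding N_power2[OF x, symmetric] a_def[symmetric]
      using ra a by (intro divide_left_mono power_mono mult_pos_pos) auto
    finally have h: "H (x + r' *\<^sub>R v) v v \<le> a\<^sup>2 / (1 - a)\<^sup>2" .
    have "r * H (x + r' *\<^sub>R v) v v \<le> 1 * (a\<^sup>2 / (1 - a)\<^sup>2)"
      using r s h H_nonneg[OF D] by (intro mult_mono) auto
    hence g: "v \<bullet> grad f (x + r *\<^sub>R v) \<le> \<bar>v \<bullet> grad f x\<bar> + a\<^sup>2 / (1 - a)\<^sup>2" using r'(3) by simp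
    have "s * (v \<bullet> grad f (x + r *\<^sub>R v)) \<le> s * (\<bar>v \<bullet> grad f x\<bar> + a\<^sup>2 / (1 - a)\<^sup>2)"
      using g s by (intro mult_left_mono) auto
    also have "\<dots> \<le> 1 * (\<bar>v \<bullet> grad f x\<bar> + a\<^sup>2 / (1 - a)\<^sup>2)"
      using s by (intro mult_right_mono) auto
    finally show ?thesis using r(3) by (simp add: M_def)
  qed
  define S where "S = {t \<in> {0..1}. x + t *\<^sub>R v \<in> D}"
  have "S = {0..1} \<inter> {t. x + t *\<^sub>R v \<in> D}" by (simp only: S_def Int_def mem_Collect_eq)
  hence op: "openin (top_of_set {0..1}) S" by (simp only: openin_open_Int open_line)
  have S_eq: "S = {0..1} \<inter> (\<lambda>t. (x + t *\<^sub>R v, M)) -` eepigraph f"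
  proof -
    have "x + t *\<^sub>R v \<in> D \<longleftrightarrow> f (x + t *\<^sub>R v) \<le> ereal M" if "0 \<le> t" "t \<le> 1" for t
      using bound[OF that] f_eq_F[of "x + t *\<^sub>R v"] by (auto simp: effdom_def)
    thus ?thesis by (auto simp: S_def eepigraph_def)
  qed
  have "closed ((\<lambda>t. (x + t *\<^sub>R v, M)) -` eepigraph f)"
    by (rule closed_vimage[OF f_closed[unfolded closed_fun_def]]) (intro continuous_intros)
  hence cl: "closedin (top_of_set {0..1}) S" unfolding S_eq closedin_closed by blast
  have "0 \<in> S" using x by (simp add: S_def)
  moreover have "connected {0..1::real}" by simp
  ultimately have "S = {0..1}" using op cl unfolding connected_clopen by blast
  hence "1 \<in> S" by simp
  thus ?thesis by (simp add: S_def)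
qed

end

section \<open>The Frank--Wolfe subroutine\<close>

text \<open>\<open>h\<close> is the primal gap and \<open>V\<close> the Frank-Wolfe gap. The first
  \<open>n\<close> steps bring \<open>h\<close> down to at most \<open>2 * R / (n + 2)\<close>; each
  of the next \<open>n\<close> steps removes at least \<open>e\<^sup>2 / (2 * R)\<close>. As
  \<open>h\<close> stays nonnegative, \<open>(n * e)\<^sup>2 \<le> (2 * R)\<^sup>2\<close>.\<close>

lemma quadratic_descent_rate:
  fixes h V :: "nat \<Rightarrow> real"
  assumes R: "0 < R" and e: "0 < e" and h0: "\<And>t. t \<le> 2 * n \<Longrightarrow> 0 \<le> h t"
    and V: "\<And>t. t < 2 * n \<Longrightarrow> e < V t" "\<And>t. t < 2 * n \<Longrightarrow> h t \<le> V t" "\<And>t. t < 2 * n \<Longrightarrow> V t \<le> R"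
    and step: "\<And>t. t < 2 * n \<Longrightarrow> h (Suc t) \<le> h t - (V t)\<^sup>2 / (2 * R)"
  shows "real n \<le> 2 * R / e"
proof (cases "n = 0")
  case False
  have slow: "h t * (real t + 2) \<le> 2 * R" if "t \<le> 2 * n" for t
    using that
  proof (induction t)
    case 0
    thus ?case using V(2,3)[of 0] False by simp
  next
    case (Suc t)
    hence t: "t < 2 * n" by simp
    define k where "k = real t + 2"
    define b where "b = 2 * R / k"
    have k: "k \<ge> 2" by (simp add: k_def)
    have hb: "h t \<le> b" using Suc k by (simp add: b_def k_def field_simps)
    have bR: "b \<le> R" using k R by (simp add: b_def field_simps)
    have ht: "0 \<le> h t" using h0 t by simp
    have "(h t)\<^sup>2 \<le> (V t)\<^sup>2" using ht V(2)[OF t] by (intro power_mono) auto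
    hence "2 * R * h (Suc t) \<le> 2 * R * h t - (h t)\<^sup>2"
      using step[OF t] R by (simp add: field_simps)
    \<comment> \<open>The function \<open>2 * R * h - h\<^sup>2\<close> increases up to
      \<open>h = R\<close>; the shift 2 in \<open>k\<close> ensures \<open>b \<le> R\<close> and
      also fits the start \<open>h 0 \<le> R\<close>.\<close>
    also have "\<dots> \<le> 2 * R * b - b\<^sup>2"
    proof -
      have "0 \<le> (b - h t) * (2 * R - b - h t)" using hb bR ht by (intro mult_nonneg_nonneg) auto
      thus ?thesis by (simp add: power2_eq_square algebra_simps)
    qed
    finally have "2 * R * h (Suc t) * (k + 1) \<le> (2 * R * b - b\<^sup>2) * (k + 1)"
      using k by (intro mult_right_mono) auto
    also have "\<dots> = 2 * R * (2 * R - b / k)"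
      using k by (simp add: b_def power2_eq_square field_simps)
    also have "\<dots> \<le> 2 * R * (2 * R)" using R k by (intro mult_left_mono) (auto simp: b_def)
    finally have "h (Suc t) * (k + 1) \<le> 2 * R" using R by (simp add: mult.commute)
    thus ?case by (simp add: k_def algebra_simps)
  qed
  have drop: "h (n + m) \<le> h n - real m * (e\<^sup>2 / (2 * R))" if "m \<le> n" for m
    using that
  proof (induction m)
    case (Suc m)
    hence t: "n + m < 2 * n" by simp
    have "e\<^sup>2 \<le> (V (n + m))\<^sup>2" using V(1)[OF t] e by (intro power_mono) auto
    hence "e\<^sup>2 / (2 * R) \<le> (V (n + m))\<^sup>2 / (2 * R)" using R by (simp add: divide_right_mono)
    hence "h (n + Suc m) \<le> h (n + m) - e\<^sup>2 / (2 * R)" using step[OF t] by simp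
    also have "\<dots> \<le> h n - real m * (e\<^sup>2 / (2 * R)) - e\<^sup>2 / (2 * R)" using Suc by simp
    also have "\<dots> = h n - real (Suc m) * (e\<^sup>2 / (2 * R))"
      unfolding of_nat_Suc distrib_right by simp
    finally show ?case .
  qed simp
  have "0 \<le> h n - real n * (e\<^sup>2 / (2 * R))" using drop[of n] h0[of "n + n"] by simp
  hence "real n * (e\<^sup>2 / (2 * R)) \<le> h n" by simp
  hence "real n * (e\<^sup>2 / (2 * R)) * real n \<le> h n * (real n + 2)"
    using h0[of n] by (intro mult_mono) auto
  also have "\<dots> \<le> 2 * R" using slow[of n] by simp
  finally have "(real n * e)\<^sup>2 \<le> (2 * R)\<^sup>2" using R by (simp add: field_simps power2_eq_square)
  hence "real n * e \<le> 2 * R" by (rule power2_le_imp_le) (use R in simp)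
  thus ?thesis using e by (simp add: field_simps)
qed (use R e in auto)

section \<open>Descent and termination of a Frank-Wolfe run\<close>

locale fw_quadratic =
  fixes q :: "real^'n" and M :: "real^'n^'n" and u0 :: "real^'n"
  assumes inner: "bilinear_inner (\<lambda>v w. v \<bullet> (M *v w))"
    and M_pos: "v \<noteq> 0 \<Longrightarrow> 0 < v \<bullet> (M *v v)"
begin

sublocale bilinear_inner "\<lambda>v w. v \<bullet> (M *v w)" by (rule inner)

text \<open>The objective of the subproblem, normalised to vanish at \<open>u0\<close>; its gradient
  at \<open>u\<close> is \<open>fw_grad q M u0 u\<close>.\<close>

definition model where "model u = q \<bullet> (u - u0) + (u - u0) \<bullet> (M *v (u - u0)) / 2"

lemma model_line:
  "model (u + t *\<^sub>R d) = model u + t * (fw_grad q M u0 u \<bullet> d) + t\<^sup>2 * (d \<bullet> (M *v d)) / 2"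
proof -
  define w where "w = u - u0"
  have "u + t *\<^sub>R d - u0 = w + t *\<^sub>R d" by (simp add: w_def)
  moreover have "(M *v w) \<bullet> d = d \<bullet> (M *v w)" by (simp add: inner_commute)
  ultimately show ?thesis
    unfolding model_def fw_grad_def w_def[symmetric]
    by (simp add: expand(1,3,4,6) sym[of w d] inner_add_left inner_add_right power2_eq_square algebra_simps)
qed

text \<open>A step is the exact line search on the segment from \<open>u\<close> to
  \<open>v\<close>. A full step gains at least half the gap, an interior one
  \<open>V\<^sup>2 / (2 * \<delta>)\<close>; bounding both the gap and the curvature by
  \<open>R\<close> gives one gain for both cases.\<close>

lemma fw_step_descent:
  assumes V: "0 < fw_gap q M u0 u v" "fw_gap q M u0 u v \<le> R"
    and d: "(v - u) \<bullet> (M *v (v - u)) \<le> R"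
  shows "model (fw_step q M u0 u v) \<le> model u - (fw_gap q M u0 u v)\<^sup>2 / (2 * R)"
    and "\<exists>t\<in>{0..1}. fw_step q M u0 u v = (1 - t) *\<^sub>R u + t *\<^sub>R v"
proof -
  define V where "V = fw_gap q M u0 u v"
  define \<delta> where "\<delta> = (v - u) \<bullet> (M *v (v - u))"
  define t where "t = min 1 (V / \<delta>)"
  have V0: "0 < V" "V \<le> R" using V by (auto simp: V_def)
  have g: "fw_grad q M u0 u \<bullet> (v - u) = - V" by (simp add: V_def fw_gap_def inner_diff_right)
  have "v \<noteq> u" using V by (auto simp: fw_gap_def)
  hence \<delta>: "0 < \<delta>" "\<delta> \<le> R" using M_pos d by (auto simp: \<delta>_def)
  have t: "0 \<le> t" "t \<le> 1" using V0 \<delta> by (auto simp: t_def)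
  have eq: "fw_step q M u0 u v = (1 - t) *\<^sub>R u + t *\<^sub>R v"
    by (simp add: fw_step_def Let_def t_def V_def \<delta>_def)
  thus "\<exists>t\<in>{0..1}. fw_step q M u0 u v = (1 - t) *\<^sub>R u + t *\<^sub>R v" using t by auto
  have "fw_step q M u0 u v = u + t *\<^sub>R (v - u)" unfolding eq by (simp add: algebra_simps)
  hence m: "model (fw_step q M u0 u v) = model u - t * V + t\<^sup>2 * \<delta> / 2"
    using model_line[of u t "v - u"] g by (simp add: \<delta>_def)
  have "V\<^sup>2 / (2 * R) \<le> t * V - t\<^sup>2 * \<delta> / 2"
  proof (cases "\<delta> \<le> V")
    case True
    have "V\<^sup>2 / (2 * R) \<le> V / 2" using V0 by (simp add: field_simps power2_eq_square)
    moreover have "t = 1" using True \<delta> by (simp add: t_def)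
    ultimately show ?thesis using True by simp
  next
    case False
    hence "t = V / \<delta>" using \<delta> by (simp add: t_def)
    hence "V = t * \<delta>" using \<delta> by simp
    hence "t * V - t\<^sup>2 * \<delta> / 2 = V\<^sup>2 / (2 * \<delta>)" using \<delta> by (simp add: power2_eq_square)
    also have "\<dots> \<ge> V\<^sup>2 / (2 * R)" using \<delta> V0 by (intro divide_left_mono) auto
    finally show ?thesis .
  qed
  thus "model (fw_step q M u0 u v) \<le> model u - (fw_gap q M u0 u v)\<^sup>2 / (2 * R)"
    unfolding m by (simp add: V_def)
qed

text \<open>Oracle answers and iterates are specified only while all earlier tests have failed, so
  membership in \<open>X\<close> and descent are shown under that hypothesis. If none of the first
  \<open>2 * n\<close> tests succeeded, \<open>quadratic_descent_rate\<close> would contradict the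
  choice of \<open>n\<close> as the least integer strictly above \<open>2 * R / e\<close>.\<close>

lemma fw_run_stops:
  assumes X: "compact X" "convex X" "u0 \<in> X" and run: "fw_run X q M u0 e u v" and e: "0 < e" and R: "0 < R"
    and d: "\<And>a b. a \<in> X \<Longrightarrow> b \<in> X \<Longrightarrow> (a - b) \<bullet> (M *v (a - b)) \<le> R"
    and g: "\<And>a b. a \<in> X \<Longrightarrow> b \<in> X \<Longrightarrow> fw_gap q M u0 a b \<le> R"
  obtains t where "fw_stops_at q M u0 e u v t" "real (Suc t) \<le> 4 * R / e + 2"
    "u t \<in> X" "\<And>s. s \<in> X \<Longrightarrow> fw_gap q M u0 (u t) s \<le> e"
proof -
  let ?V = "\<lambda>t. fw_gap q M u0 (u t) (v t)"
  have u0: "u 0 = u0" using run by (simp add: fw_run_def)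
  have lmo: "v t \<in> X" "\<And>s. s \<in> X \<Longrightarrow> fw_gap q M u0 (u t) s \<le> ?V t" if "\<forall>s<t. ?V s > e" for t
    using run that unfolding fw_run_def is_arg_max_def fw_gap_def by (auto simp: not_less)
  have next_u: "u (Suc t) = fw_step q M u0 (u t) (v t)" if "\<forall>s<Suc t. ?V s > e" for t
    using run that unfolding fw_run_def by auto
  have uX: "u t \<in> X" if "\<forall>s<t. ?V s > e" for t
    using that
  proof (induction t)
    case 0
    thus ?case using u0 X by simp
  next
    case (Suc t)
    hence i: "u t \<in> X" "v t \<in> X" "?V t > e" using lmo(1)[of t] by auto
    have "0 < ?V t" using i e by simp
    from fw_step_descent(2)[OF this g[OF i(1,2)] d[OF i(2,1)]]
    obtain r where "r \<in> {0..1}" "fw_step q M u0 (u t) (v t) = (1 - r) *\<^sub>R u t + r *\<^sub>R v t" by blast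
    thus ?case using next_u[OF Suc.prems] i convexD[OF X(2), of "u t" "v t" "1 - r" r] by simp
  qed
  obtain w where w: "w \<in> X" "\<And>y. y \<in> X \<Longrightarrow> model w \<le> model y"
  proof -
    have "continuous_on X (\<lambda>x. M *v (x - u0))"
      by (rule continuous_on_compose2[OF matrix_vector_mult_linear_continuous_on[of UNIV]])
        (auto intro!: continuous_intros)
    hence "continuous_on X model" unfolding model_def by (intro continuous_intros) auto
    thus ?thesis using continuous_attains_inf[OF X(1), of model] X(3) that by blast
  qed
  define n where "n = nat \<lfloor>2 * R / e\<rfloor> + 1"
  have n: "2 * R / e < real n" "real n \<le> 2 * R / e + 1"
    using R e by (simp_all add: n_def) linarith+
  have "\<exists>t<2 * n. ?V t \<le> e"
  proof (rule ccontr)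
    assume "\<not> (\<exists>t<2 * n. ?V t \<le> e)"
    hence big: "\<forall>s<t. ?V s > e" if "t \<le> 2 * n" for t using that by (auto simp: not_le)
    have "real n \<le> 2 * R / e"
    proof (rule quadratic_descent_rate[OF R e, where h = "\<lambda>t. model (u t) - model w" and V = ?V])
      fix t assume t: "t < 2 * n"
      hence b: "\<forall>s<t. ?V s > e" "?V t > e" using big[of "Suc t"] by auto
      note i = uX[OF b(1)] lmo(1)[OF b(1)]
      show "?V t > e" by fact
      show "?V t \<le> R" using g i by blast
      have "0 < ?V t" using b e by simp
      from fw_step_descent(1)[OF this g[OF i] d[OF i(2,1)]]
      show "model (u (Suc t)) - model w \<le> model (u t) - model w - (?V t)\<^sup>2 / (2 * R)"
        using next_u[of t] big[of "Suc t"] t by simp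
      \<comment> \<open>By convexity the model lies above its tangent at \<open>u t\<close>, so the
        primal gap is at most the Frank-Wolfe gap at \<open>w\<close>, hence at most that at the
        oracle answer.\<close>
      have "model w = model (u t + 1 *\<^sub>R (w - u t))" by simp
      also have "\<dots> \<ge> model (u t) - fw_gap q M u0 (u t) w"
        unfolding model_line using nonneg[of "w - u t"] by (simp add: fw_gap_def inner_diff_right)
      finally show "model (u t) - model w \<le> ?V t" using lmo(2)[OF b(1) w(1)] by linarith
    next
      fix t assume "t \<le> 2 * n"
      thus "0 \<le> model (u t) - model w" using w(2)[OF uX[OF big]] by simp
    qed
    thus False using n by simp
  qed
  then obtain t0 where t0: "t0 < 2 * n" "?V t0 \<le> e" by blast
  \<comment> \<open>The run stops at the least index that passes the test; it has then made
    \<open>Suc t\<close> oracle calls, one for every index up to \<open>t\<close>.\<close>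
  then obtain t where t': "?V t \<le> e" "\<forall>s<t. \<not> ?V s \<le> e"
    using exists_least_iff[of "\<lambda>t. ?V t \<le> e"] by blast
  hence t: "?V t \<le> e" "\<forall>s<t. ?V s > e" by (auto simp: not_le)
  have "t \<le> t0" using t'(2) t0(2) by (metis not_le)
  hence "Suc t \<le> 2 * n" using t0(1) by linarith
  hence "real (Suc t) \<le> 2 * real n" by (metis of_nat_le_iff of_nat_mult of_nat_numeral)
  also have "\<dots> \<le> 4 * R / e + 2" using n(2) by simp
  finally have "real (Suc t) \<le> 4 * R / e + 2" .
  thus thesis
    using t uX[OF t(2)] order_trans[OF lmo(2)[OF t(2)] t(1)] by (intro that) (auto simp: fw_stops_at_def)
qed

end

section \<open>The full-step scheme\<close>

locale newton_fw = nondegenerate_sc f for f :: "real^'n \<Rightarrow> ereal" +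
  fixes X :: "(real^'n) set" and y :: "real^'n" and \<sigma> \<beta> C :: real
  assumes X: "compact X" "convex X"
    and y_min: "is_arg_min f (\<lambda>x. x \<in> X) y" and y_dom: "y \<in> effdom f"
    and \<sigma>: "0 < \<sigma>" "\<sigma> < 1" and \<beta>: "0 < \<beta>" "\<beta> < 1/2" and C: "C > 1"
    and cond1: "1 / (C * (1 - \<beta>)) + \<beta> / ((1 - 2 * \<beta>) * (1 - \<beta>)\<^sup>2) \<le> \<sigma>"
    and cond2: "1 / C + 1 / (1 - 2 * \<beta>) \<le> 2"
begin

section \<open>Consequences of the parameter conditions and of optimality\<close>

lemma y_in_X: "y \<in> X" using y_min by (simp add: is_arg_min_def)

lemma F_min: "x \<in> X \<Longrightarrow> x \<in> D \<Longrightarrow> F y \<le> F x"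
  using y_min y_dom f_eq_F by (auto simp: is_arg_min_def not_less)

text \<open>Here \<open>cond2\<close> enters: since \<open>1 / C\<close> is positive,
  \<open>1 / (1 - 2 * \<beta>)\<close> is below 2. The numerical constants of
  \<open>newton_step\<close> rest on this.\<close>

lemma \<beta>_quarter: "\<beta> < 1/4"
proof -
  have "1 / C > 0" using C by simp
  hence "1 / (1 - 2 * \<beta>) < 2" using cond2 by linarith
  thus ?thesis using \<beta> by (simp add: field_simps)
qed

text \<open>A negative slope towards \<open>z\<close> would allow a short step from \<open>y\<close>
  that stays in the domain by openness, stays in \<open>X\<close> by convexity and lowers
  \<open>F\<close>.\<close>

lemma first_order_optimality:
  assumes z: "z \<in> X" shows "0 \<le> (z - y) \<bullet> grad f y"
proof (rule ccontr)
  define v where "v = z - y"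
  assume "\<not> 0 \<le> (z - y) \<bullet> grad f y"
  hence neg: "v \<bullet> grad f (y + 0 *\<^sub>R v) < 0" by (simp add: v_def)
  have y0: "y + 0 *\<^sub>R v \<in> D" using y_dom by simp
  obtain d where d: "d > 0" "\<And>h. 0 < h \<Longrightarrow> h < d \<Longrightarrow> F (y + (0 + h) *\<^sub>R v) < F (y + 0 *\<^sub>R v)"
    using DERIV_neg_dec_right[OF F_line[OF y0] neg] by blast
  obtain e where e: "e > 0" "ball 0 e \<subseteq> {t. y + t *\<^sub>R v \<in> D}"
    using open_contains_ball[of "{t. y + t *\<^sub>R v \<in> D}"] open_line[of y v] y0 by blast
  define h where "h = min d (min e 1) / 2"
  have h: "0 < h" "h < d" "h < e" "h < 1" using d e by (auto simp: h_def)
  have "h \<in> ball 0 e" using h by simp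
  hence hD: "y + h *\<^sub>R v \<in> D" using e by blast
  have "y + h *\<^sub>R v = (1 - h) *\<^sub>R y + h *\<^sub>R z" by (simp add: v_def algebra_simps)
  hence "y + h *\<^sub>R v \<in> X" using convexD[OF X(2) y_in_X z, of "1 - h" h] h by simp
  from F_min[OF this hD] d(2)[OF h(1,2)] show False by simp
qed

text \<open>\<open>cond1\<close> multiplied by \<open>1 - \<beta>\<close>:
  \<open>newton_step\<close> first bounds the error in the norm at \<open>x\<close>, and the factor
  on the right is what the return to the norm at \<open>y\<close> costs.\<close>

lemma \<sigma>_rate: "1 / C + \<beta> / ((1 - \<beta>) * (1 - 2 * \<beta>)) \<le> \<sigma> * (1 - \<beta>)"
proof -
  have p: "1 - \<beta> > 0" "1 - 2 * \<beta> > 0" using \<beta> by auto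
  have "(1 / (C * (1 - \<beta>)) + \<beta> / ((1 - 2 * \<beta>) * (1 - \<beta>)\<^sup>2)) * (1 - \<beta>) \<le> \<sigma> * (1 - \<beta>)"
    using cond1 p by (intro mult_right_mono) auto
  moreover have "(1 / (C * (1 - \<beta>)) + \<beta> / ((1 - 2 * \<beta>) * (1 - \<beta>)\<^sup>2)) * (1 - \<beta>) =
      1 / C + \<beta> / ((1 - \<beta>) * (1 - 2 * \<beta>))"
  proof -
    have "(1 / (C * p) + \<beta> / (q * p\<^sup>2)) * p = 1 / C + \<beta> / (p * q)" if "p \<noteq> 0" for p q
      using that by (simp add: distrib_right power2_eq_square)
    thus ?thesis using p by simp
  qed
  ultimately show ?thesis by simp
qed

lemma newton_step:
  assumes x: "x \<in> D" and r: "N y (x - y) \<le> r" "0 < r" "r \<le> \<beta>"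
    and z: "z \<in> X" and gap: "fw_gap (grad f x) (hess f x) x z y \<le> (r / C)\<^sup>2"
  shows "z \<in> D" and "N y (z - y) \<le> \<sigma> * r" and "F z - F y \<le> 12 * r ^ 3 + (r / C)\<^sup>2 + r\<^sup>2"
proof -
  interpret B: bilinear_inner "H x" by (rule H_inner[OF x])
  have Nx: "N x v = B.nrm v" for v by (rule local_norm_eq[OF x])
  define s where "s = x - y"
  define v where "v = y - x"
  define w where "w = z - y"
  define b where "b = N x v"
  define n where "n = N x w"
  define \<eta> where "\<eta> = r / C"
  have \<eta>: "0 < \<eta>" using r C by (simp add: \<eta>_def)
  have b0: "0 \<le> b" and n0: "0 \<le> n" using N_nonneg[OF x] by (auto simp: b_def n_def)
  have p: "1 - \<beta> > 0" "1 - 2 * \<beta> > 0" "1 - r > 0" "1 - 2 * r > 0" using \<beta> r by auto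
  have s0: "0 \<le> N y s" "N y s \<le> r" using N_nonneg[OF y_dom] r by (auto simp: s_def)
  have xs: "y + 1 *\<^sub>R s = x" by (simp add: s_def)
  have sm: "1 * N y s < 1" using s0 p by linarith
  have v_s: "N x v = N x s"
    using B.nrm_scale[of "-1" s] by (simp add: Nx v_def s_def)
  have b: "b \<le> r / (1 - r)"
  proof -
    have "b \<le> N y s / (1 - N y s)"
      using N_growth[OF y_dom _ _ sm] x xs by (simp add: b_def v_s)
    also have "\<dots> \<le> r / (1 - r)" using s0 p by (intro frac_le) auto
    finally show ?thesis .
  qed
  have b1: "1 - b \<ge> (1 - 2 * r) / (1 - r)"
  proof -
    have "1 - r / (1 - r) = (1 - 2 * r) / (1 - r)" using p by (simp add: field_simps)
    thus ?thesis using b by linarith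
  qed
  hence bl: "b < 1" using divide_pos_pos[OF p(4,3)] by linarith
  define \<kappa> where "\<kappa> = b\<^sup>2 / (1 - b)"
  \<comment> \<open>One factor \<open>r\<close> is kept, the other is replaced by \<beta>, which
    matches the second term of \<open>\<sigma>_rate\<close>.\<close>
  have \<kappa>: "\<kappa> \<le> r * (\<beta> / ((1 - \<beta>) * (1 - 2 * \<beta>)))"
  proof -
    have "\<kappa> \<le> (r / (1 - r))\<^sup>2 / ((1 - 2 * r) / (1 - r))"
      unfolding \<kappa>_def using b b0 b1 p by (intro frac_le power_mono) auto
    also have "\<dots> = r * (r / ((1 - r) * (1 - 2 * r)))" using p by (simp add: power2_eq_square)
    also have "\<dots> \<le> r * (\<beta> / ((1 - \<beta>) * (1 - 2 * \<beta>)))"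
      using r p by (intro mult_left_mono frac_le mult_mono mult_pos_pos) auto
    finally show ?thesis .
  qed
  have \<kappa>0: "0 \<le> \<kappa>" using bl by (simp add: \<kappa>_def)
  have zx: "z - x = w + v" by (simp add: w_def v_def)
  have gap': "w \<bullet> grad f x + H x w (w + v) \<le> \<eta>\<^sup>2"
    using gap by (simp add: fw_gap_def fw_grad_def \<eta>_def H_def zx w_def[symmetric] inner_commute inner_add_right)
  have opt: "0 \<le> w \<bullet> grad f y" using first_order_optimality[OF z] by (simp add: w_def)
  have "w \<bullet> grad f (x + v) - w \<bullet> grad f x - H x w v \<le> n * \<kappa>"
    unfolding n_def \<kappa>_def b_def
    using bl y_dom by (intro grad_remainder[OF x]) (auto simp: b_def v_def)
  hence rem: "w \<bullet> grad f y - w \<bullet> grad f x - H x w v \<le> n * \<kappa>" by (simp add: v_def)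
  have nn: "n\<^sup>2 = H x w w" by (simp add: n_def N_power2[OF x])
  \<comment> \<open>Adding the three inequalities cancels the gradients and the mixed term
    \<open>H x w v\<close>.\<close>
  have "n\<^sup>2 \<le> \<eta>\<^sup>2 + n * \<kappa>" using gap' opt rem unfolding B.add_right nn by linarith
  have "n \<le> \<eta> + \<kappa>"
  proof (rule ccontr)
    assume "\<not> n \<le> \<eta> + \<kappa>"
    hence c: "\<eta> + \<kappa> < n" by simp
    hence "n * (\<eta> + \<kappa>) < n * n" using \<eta> \<kappa>0 by (intro mult_strict_left_mono) auto
    moreover have "\<eta> * \<eta> \<le> n * \<eta>" using c \<eta> \<kappa>0 by (intro mult_right_mono) auto
    ultimately show False using \<open>n\<^sup>2 \<le> \<eta>\<^sup>2 + n * \<kappa>\<close> by (simp add: power2_eq_square algebra_simps)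
  qed
  also have "\<dots> \<le> r * (1 / C + \<beta> / ((1 - \<beta>) * (1 - 2 * \<beta>)))"
    using \<kappa> unfolding \<eta>_def distrib_left by simp
  also have "\<dots> \<le> r * (\<sigma> * (1 - \<beta>))" using \<sigma>_rate r by (intro mult_left_mono) auto
  finally have n: "n \<le> r * (\<sigma> * (1 - \<beta>))" .
  \<comment> \<open>Back to the norm at \<open>y\<close>: the factor \<open>1 - \<beta>\<close>
    cancels against the one in \<open>\<sigma>_rate\<close>.\<close>
  have "(1 - \<beta>) * N y w \<le> (1 - 1 * N y s) * N y w"
    using s0 r N_nonneg[OF y_dom] by (intro mult_right_mono) auto
  also have "\<dots> \<le> n" using N_compare(2)[OF y_dom _ _ sm, of w] x xs by (simp add: n_def)
  finally have "(1 - \<beta>) * N y w \<le> (1 - \<beta>) * (\<sigma> * r)" using n by (simp add: mult_ac)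
  hence Nw: "N y w \<le> \<sigma> * r" using p by simp
  thus "N y (z - y) \<le> \<sigma> * r" by (simp add: w_def)
  have \<sigma>r: "\<sigma> * r \<le> 1 * r" using \<sigma> r by (intro mult_right_mono) auto
  have "y + w \<in> D" using Nw \<sigma>r p by (intro dikin[OF y_dom]) linarith
  thus zD: "z \<in> D" by (simp add: w_def)
  define a where "a = N x (z - x)"
  have a0: "0 \<le> a" using N_nonneg[OF x] by (simp add: a_def)
  have a: "a \<le> 25 / 12 * r"
  proof -
    have "a \<le> n + b" unfolding a_def n_def b_def zx Nx by (rule B.nrm_triangle)
    also have "n \<le> r * (1 - \<beta>)"
    proof -
      have "r * (\<sigma> * (1 - \<beta>)) \<le> r * (1 * (1 - \<beta>))"
        using \<sigma> p r by (intro mult_left_mono mult_right_mono) auto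
      thus ?thesis using n by simp
    qed
    also have "b \<le> r * (1 / (1 - \<beta>))"
    proof -
      have "r / (1 - r) \<le> r / (1 - \<beta>)" using r p by (intro divide_left_mono) auto
      thus ?thesis using b by simp
    qed
    also have "r * (1 - \<beta>) + r * (1 / (1 - \<beta>)) = r * ((1 - \<beta>) + 1 / (1 - \<beta>))" by (simp only: distrib_left)
    \<comment> \<open>A number between 3/4 and 4/3 plus its reciprocal is at most 3/4 + 4/3 = 25/12;
      \<open>\<beta>_quarter\<close> puts \<open>1 - \<beta>\<close> into this range, and the
      product below expresses it.\<close>
    also have "\<dots> \<le> r * (25 / 12)"
    proof (rule mult_left_mono)
      have "0 \<le> (4 * (1 - \<beta>) - 3) * (4 - 3 * (1 - \<beta>))" using \<beta> \<beta>_quarter by (intro mult_nonneg_nonneg) auto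
      hence "12 * ((1 - \<beta>) * (1 - \<beta>)) + 12 \<le> 25 * (1 - \<beta>)" by (simp add: algebra_simps)
      moreover have "p + 1 / p \<le> 25 / 12" if "12 * (p * p) + 12 \<le> 25 * p" "0 < p" for p :: real
        using that by (simp add: field_simps)
      ultimately show "(1 - \<beta>) + 1 / (1 - \<beta>) \<le> 25 / 12" using p(1) by blast
    qed (use r in simp)
    finally show ?thesis by simp
  qed
  have a1: "a \<le> 25 / 48" using a r \<beta>_quarter by simp
  have upper: "F z \<le> F x + (z - x) \<bullet> grad f x + a\<^sup>2 / 2 + a ^ 3 * (2 - a) / (6 * (1 - a)\<^sup>2)"
    unfolding a_def using F_upper[OF x, of "z - x"] zD a1 by (simp add: a_def)
  \<comment> \<open>With \<open>a \<le> 25 / 48\<close> the quotient by which \<open>a ^ 3\<close>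
    is multiplied is at most 11/10, and \<open>(25 / 12) ^ 3 * (11 / 10)\<close> is below
    12.\<close>
  have cubic: "a ^ 3 * (2 - a) / (6 * (1 - a)\<^sup>2) \<le> 12 * r ^ 3"
  proof -
    define p where "p = 1 - a"
    have "23 / 48 \<le> p" using a1 by (simp add: p_def)
    moreover from this have "23 / 48 * p \<le> p * p" by (intro mult_right_mono) auto
    ultimately have "1 + p \<le> 33 / 5 * p\<^sup>2" unfolding power2_eq_square by linarith
    hence "2 - a \<le> 33 / 5 * (1 - a)\<^sup>2" by (simp add: p_def)
    hence "(2 - a) / (6 * (1 - a)\<^sup>2) \<le> 11 / 10" using a1 by (simp add: divide_le_eq)
    hence "a ^ 3 * ((2 - a) / (6 * (1 - a)\<^sup>2)) \<le> a ^ 3 * (11 / 10)" using a0 by (intro mult_left_mono) auto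
    also have "\<dots> \<le> (25 / 12 * r) ^ 3 * (11 / 10)" using a a0 by (intro mult_right_mono power_mono) auto
    also have "\<dots> \<le> 12 * r ^ 3" using r by (simp add: power_mult_distrib power_divide)
    finally show ?thesis by simp
  qed
  \<comment> \<open>The bound 4/3 on \<open>1 / (1 - r)\<close> has square 16/9; rounded up to 2,
    half of it yields the last term \<open>r\<^sup>2\<close>.\<close>
  have bsq: "b\<^sup>2 \<le> 2 * r\<^sup>2"
  proof -
    have "r / (1 - r) \<le> r / (3 / 4)" using r \<beta>_quarter by (intro divide_left_mono) auto
    also have "r / (3 / 4) = 4 / 3 * r" by simp
    finally have "b \<le> 4 / 3 * r" using b by linarith
    hence "b\<^sup>2 \<le> (4 / 3 * r)\<^sup>2" using b0 by (intro power_mono)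
    also have "\<dots> \<le> 2 * r\<^sup>2" by (simp add: power_mult_distrib power_divide)
    finally show ?thesis .
  qed
  \<comment> \<open>The cosine rule for the triangle \<open>x\<close>, \<open>y\<close>,
    \<open>z\<close>. Through \<open>gap'\<close> it brings in \<open>- a\<^sup>2 / 2\<close>, which
    cancels the quadratic term of \<open>upper\<close>.\<close>
  have polar: "2 * H x w (w + v) = a\<^sup>2 + n\<^sup>2 - b\<^sup>2"
  proof -
    have "a\<^sup>2 = H x (w + v) (w + v)" "b\<^sup>2 = H x v v" by (simp_all add: a_def b_def zx N_power2[OF x])
    thus ?thesis unfolding nn by (simp add: B.expand B.sym[of v w])
  qed
  have "F x + (y - x) \<bullet> grad f x \<le> F y" by (rule above_tangent[OF x y_dom])
  hence lower: "F x + v \<bullet> grad f x \<le> F y" by (simp add: v_def)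
  have "F z - F y \<le> w \<bullet> grad f x + a\<^sup>2 / 2 + 12 * r ^ 3"
    using upper lower cubic unfolding zx inner_add_left by linarith
  also have "\<dots> \<le> 12 * r ^ 3 + \<eta>\<^sup>2 + r\<^sup>2"
    using gap' polar bsq zero_le_power2[of n] by linarith
  finally show "F z - F y \<le> 12 * r ^ 3 + (r / C)\<^sup>2 + r\<^sup>2" by (simp add: \<eta>_def)
qed

text \<open>One \<open>R\<close> serves all stages. The \<beta>-ball around \<open>y\<close> meets
  \<open>X\<close> in a compact set that lies in the domain by \<open>dikin\<close>; gradients are
  bounded there by continuity and Hessians by comparison with the one at \<open>y\<close>.\<close>

lemma subproblem_bounds:
  obtains R where "R > 0"
    "\<And>x a b. x \<in> X \<Longrightarrow> x \<in> D \<Longrightarrow> N y (x - y) \<le> \<beta> \<Longrightarrow> a \<in> X \<Longrightarrow> b \<in> X \<Longrightarrow>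
       H x (a - b) (a - b) \<le> R \<and> fw_gap (grad f x) (hess f x) x a b \<le> R"
proof -
  define S where "S = {x \<in> X. N y (x - y) \<le> \<beta>}"
  have mv: "continuous_on UNIV (\<lambda>x. hess f y *v (x - y))"
    by (rule continuous_on_compose2[OF matrix_vector_mult_linear_continuous_on[of UNIV]])
      (auto intro!: continuous_intros)
  have "closed {x. N y (x - y) \<le> \<beta>}" unfolding local_norm_def
    by (intro closed_Collect_le continuous_intros mv)
  hence "compact (X \<inter> {x. N y (x - y) \<le> \<beta>})" by (intro compact_Int_closed X)
  moreover have "X \<inter> {x. N y (x - y) \<le> \<beta>} = S" by (auto simp: S_def)
  ultimately have S: "compact S" by simp
  have SD: "S \<subseteq> D"
  proof
    fix x assume "x \<in> S"
    thus "x \<in> D" using dikin[OF y_dom, of "x - y"] \<beta> by (simp add: S_def)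
  qed
  have "continuous_on S (grad f)"
    by (intro continuous_at_imp_continuous_on ballI has_derivative_continuous[OF grad_has_derivative]) (use SD in auto)
  hence "bounded (grad f ` S)" using compact_continuous_image[OF _ S] compact_imp_bounded by blast
  then obtain G where G: "G > 0" "\<And>x. x \<in> S \<Longrightarrow> norm (grad f x) \<le> G"
    unfolding bounded_pos by blast
  obtain d where d: "d > 0" "\<And>x. x \<in> X \<Longrightarrow> norm x \<le> d"
    using compact_imp_bounded[OF X(1)] unfolding bounded_pos by blast
  have dab: "norm (a - b) \<le> 2 * d" if "a \<in> X" "b \<in> X" for a b
    using norm_triangle_ineq4[of a b] d(2)[OF that(1)] d(2)[OF that(2)] by simp
  obtain K where K: "K > 0" "\<And>w. norm (hess f y *v w) \<le> norm w * K"
    using bounded_linear.pos_bounded[OF matrix_vector_mul_bounded_linear[of "hess f y"]] by blast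
  define Q where "Q = (2 * d) * (2 * d * K) / (1 - \<beta>)\<^sup>2"
  have Q: "Q > 0" using d K \<beta> by (simp add: Q_def)
  have HQ: "H x (a - b) (a - b) \<le> Q" if x: "x \<in> S" and ab: "a \<in> X" "b \<in> X" for x a b
  proof -
    have xb: "N y (x - y) \<le> \<beta>" using x by (simp add: S_def)
    have "H y (a - b) (a - b) \<le> norm (a - b) * norm (hess f y *v (a - b))"
      unfolding H_def by (rule norm_cauchy_schwarz)
    also have "\<dots> \<le> norm (a - b) * (norm (a - b) * K)" by (intro mult_left_mono K) auto
    also have "\<dots> \<le> (2 * d) * (2 * d * K)" using dab[OF ab] d K by (intro mult_mono) auto
    finally have *: "H y (a - b) (a - b) \<le> (2 * d) * (2 * d * K)" .
    have "H x (a - b) (a - b) \<le> H y (a - b) (a - b) / (1 - N y (x - y))\<^sup>2"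
      using H_compare(1)[OF y_dom, of 1 "x - y" "a - b"] x SD xb \<beta> by auto
    also have "\<dots> \<le> Q" unfolding Q_def
      using * xb \<beta> H_nonneg[OF y_dom] d K by (intro frac_le power_mono) auto
    finally show ?thesis .
  qed
  have gap: "fw_gap (grad f x) (hess f x) x a b \<le> G * (2 * d) + Q" if x: "x \<in> S" and ab: "a \<in> X" "b \<in> X" for x a b
  proof -
    have xD: "x \<in> D" and xX: "x \<in> X" using x SD by (auto simp: S_def)
    interpret B: bilinear_inner "H x" by (rule H_inner[OF xD])
    have "grad f x \<bullet> (a - b) \<le> norm (grad f x) * norm (a - b)" by (rule norm_cauchy_schwarz)
    also have "\<dots> \<le> G * (2 * d)" using G x dab[OF ab] by (intro mult_mono) auto
    finally have 1: "grad f x \<bullet> (a - b) \<le> G * (2 * d)" .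
    have "H x (a - b) (a - x) \<le> B.nrm (a - b) * B.nrm (a - x)" by (rule B.cauchy_schwarz)
    also have "\<dots> \<le> sqrt Q * sqrt Q"
      using HQ[OF x ab] HQ[OF x ab(1) xX] Q by (intro mult_mono) (auto simp: B.nrm_def B.nonneg)
    also have "\<dots> = Q" using Q by simp
    finally have 2: "H x (a - b) (a - x) \<le> Q" .
    have "fw_gap (grad f x) (hess f x) x a b = grad f x \<bullet> (a - b) + H x (a - b) (a - x)"
      by (simp add: fw_gap_def fw_grad_def H_def inner_add_right inner_commute)
    thus ?thesis using 1 2 by simp
  qed
  show thesis
  proof (rule that[of "G * (2 * d) + Q"])
    show "0 < G * (2 * d) + Q" using G d Q by (simp add: add_pos_pos)
    have "0 \<le> G * (2 * d)" using G d by simp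
    thus "H x (a - b) (a - b) \<le> G * (2 * d) + Q \<and> fw_gap (grad f x) (hess f x) x a b \<le> G * (2 * d) + Q"
      if "x \<in> X" "x \<in> D" "N y (x - y) \<le> \<beta>" "a \<in> X" "b \<in> X" for x a b
      using HQ[of x a b] gap[of x a b] that by (auto simp: S_def)
  qed
qed

end

section \<open>Induction over the stages\<close>

lemma fw_stops_at_unique:
  "fw_stops_at q H u0 e u v s \<Longrightarrow> fw_stops_at q H u0 e u v t \<Longrightarrow> s = t"
  unfolding fw_stops_at_def by (metis linorder_neqE_nat not_less)

context newton_fw begin

lemma fw_quadratic_at: "x \<in> D \<Longrightarrow> fw_quadratic (hess f x)"
  using H_inner[of x] H_pos[of x] unfolding fw_quadratic_def H_def by simp

text \<open>The invariant at \<open>k\<close> makes the \<open>k\<close>-th call terminate, which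
  ties \<open>x (Suc k)\<close> to the returned point; \<open>newton_step\<close> with radius
  \<open>\<beta> * \<sigma> ^ k\<close> then renews the invariant.\<close>

lemma stage:
  assumes scheme: "full_step_scheme f X x0 (\<lambda>k. \<beta> * \<sigma> ^ k / C) x u v"
    and x0: "x0 \<in> D" "x0 \<in> X" "N y (x0 - y) \<le> \<beta>"
    and R: "R > 0" "\<And>x a b. x \<in> X \<Longrightarrow> x \<in> D \<Longrightarrow> N y (x - y) \<le> \<beta> \<Longrightarrow> a \<in> X \<Longrightarrow> b \<in> X \<Longrightarrow>
       H x (a - b) (a - b) \<le> R \<and> fw_gap (grad f x) (hess f x) x a b \<le> R"
  defines "\<eta> \<equiv> \<lambda>k. \<beta> * \<sigma> ^ k / C"
  shows "x k \<in> D \<and> x k \<in> X \<and> N y (x k - y) \<le> \<beta> * \<sigma> ^ k"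
    and "\<exists>t. stage_stops_at f \<eta> x u v k t"
    and "real (stage_lmo_calls f \<eta> x u v k) \<le> 4 * R / (\<eta> k)\<^sup>2 + 2"
    and "F (x (Suc k)) - F y \<le> (12 * \<beta> ^ 3 / (1 - 2 * \<beta>) + \<beta>\<^sup>2 / C\<^sup>2 + \<beta>\<^sup>2) * \<sigma> ^ (2 * k)"
proof -
  have sk: "\<sigma> ^ k \<le> 1" "0 < \<sigma> ^ k" for k using \<sigma> by (simp_all add: power_le_one)
  have step: "\<exists>t. stage_stops_at f \<eta> x u v k t \<and> real (Suc t) \<le> 4 * R / (\<eta> k)\<^sup>2 + 2 \<and>
      x (Suc k) \<in> X \<and> fw_gap (grad f (x k)) (hess f (x k)) (x k) (x (Suc k)) y \<le> (\<eta> k)\<^sup>2"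
    if inv: "x k \<in> D \<and> x k \<in> X \<and> N y (x k - y) \<le> \<beta> * \<sigma> ^ k" for k
  proof -
    have run: "fw_run X (grad f (x k)) (hess f (x k)) (x k) ((\<eta> k)\<^sup>2) (u k) (v k)"
      and out: "\<And>t. stage_stops_at f \<eta> x u v k t \<Longrightarrow> x (Suc k) = u k t"
      using scheme unfolding full_step_scheme_def \<eta>_def by auto
    have "\<beta> * \<sigma> ^ k \<le> \<beta>" using sk[of k] \<beta> by simp
    hence near: "N y (x k - y) \<le> \<beta>" using inv by linarith
    interpret Q: fw_quadratic "grad f (x k)" "hess f (x k)" "x k" by (rule fw_quadratic_at) (use inv in blast)
    have "0 < \<eta> k" unfolding \<eta>_def using \<beta> C sk[of k] by (intro divide_pos_pos mult_pos_pos) auto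
    hence e: "0 < (\<eta> k)\<^sup>2" by simp
    obtain t where "fw_stops_at (grad f (x k)) (hess f (x k)) (x k) ((\<eta> k)\<^sup>2) (u k) (v k) t"
      "real (Suc t) \<le> 4 * R / (\<eta> k)\<^sup>2 + 2" "u k t \<in> X"
      "\<And>s. s \<in> X \<Longrightarrow> fw_gap (grad f (x k)) (hess f (x k)) (x k) (u k t) s \<le> (\<eta> k)\<^sup>2"
      by (rule Q.fw_run_stops[OF X _ run e R(1)])
       (use inv R(2)[of "x k"] near in \<open>auto simp: H_def\<close>)
    thus ?thesis using out[of t] y_in_X unfolding stage_stops_at_def by auto
  qed
  have newton: "x (Suc k) \<in> D" "N y (x (Suc k) - y) \<le> \<sigma> * (\<beta> * \<sigma> ^ k)"
    "F (x (Suc k)) - F y \<le> 12 * (\<beta> * \<sigma> ^ k) ^ 3 + (\<eta> k)\<^sup>2 + (\<beta> * \<sigma> ^ k)\<^sup>2"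
    if inv: "x k \<in> D \<and> x k \<in> X \<and> N y (x k - y) \<le> \<beta> * \<sigma> ^ k" for k
  proof -
    have b: "0 < \<beta> * \<sigma> ^ k" "\<beta> * \<sigma> ^ k \<le> \<beta>" using sk[of k] \<beta> by simp_all
    have "x (Suc k) \<in> X" "fw_gap (grad f (x k)) (hess f (x k)) (x k) (x (Suc k)) y \<le> (\<beta> * \<sigma> ^ k / C)\<^sup>2"
      using step[OF inv] unfolding \<eta>_def by blast+
    note * = newton_step[OF _ _ b this]
    show "x (Suc k) \<in> D" "N y (x (Suc k) - y) \<le> \<sigma> * (\<beta> * \<sigma> ^ k)"
      "F (x (Suc k)) - F y \<le> 12 * (\<beta> * \<sigma> ^ k) ^ 3 + (\<eta> k)\<^sup>2 + (\<beta> * \<sigma> ^ k)\<^sup>2"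
      using * inv unfolding \<eta>_def by blast+
  qed
  have inv: "x k \<in> D \<and> x k \<in> X \<and> N y (x k - y) \<le> \<beta> * \<sigma> ^ k" for k
  proof (induction k)
    case 0
    thus ?case using scheme x0 by (simp add: full_step_scheme_def)
  next
    case (Suc k)
    thus ?case using newton(1,2)[OF Suc] step[OF Suc] by (auto simp: mult_ac)
  qed
  show "x k \<in> D \<and> x k \<in> X \<and> N y (x k - y) \<le> \<beta> * \<sigma> ^ k" by (rule inv)
  obtain t where t: "stage_stops_at f \<eta> x u v k t" "real (Suc t) \<le> 4 * R / (\<eta> k)\<^sup>2 + 2"
    using step[OF inv, of k] by blast
  show "\<exists>t. stage_stops_at f \<eta> x u v k t" using t(1) by blast
  have "(THE t. stage_stops_at f \<eta> x u v k t) = t"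
    by (rule the_equality[where P = "stage_stops_at f \<eta> x u v k", OF t(1)])
      (use t(1) in \<open>auto simp: stage_stops_at_def intro: fw_stops_at_unique\<close>)
  thus "real (stage_lmo_calls f \<eta> x u v k) \<le> 4 * R / (\<eta> k)\<^sup>2 + 2" using t(2) by (simp add: stage_lmo_calls_def)
  \<comment> \<open>One of the three factors \<open>\<sigma> ^ k\<close> is dropped, and the
    constant is then enlarged by \<open>1 / (1 - 2 * \<beta>)\<close> to reach the stated
    form.\<close>
  have "(\<beta> * \<sigma> ^ k) ^ 3 \<le> \<beta> ^ 3 * \<sigma> ^ (2 * k)"
  proof -
    have "(\<beta> * \<sigma> ^ k) ^ 3 = \<beta> ^ 3 * \<sigma> ^ (2 * k) * \<sigma> ^ k"
      by (simp add: power_mult_distrib power_mult[symmetric] power_add[symmetric] mult.commute)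
    also have "\<dots> \<le> \<beta> ^ 3 * \<sigma> ^ (2 * k) * 1" using sk[of k] \<beta> \<sigma> by (intro mult_left_mono) auto
    finally show ?thesis by simp
  qed
  moreover have "\<beta> ^ 3 \<le> \<beta> ^ 3 / (1 - 2 * \<beta>)" using \<beta> by (simp add: le_divide_eq mult_left_le)
  hence "\<beta> ^ 3 * \<sigma> ^ (2 * k) \<le> \<beta> ^ 3 / (1 - 2 * \<beta>) * \<sigma> ^ (2 * k)" using \<sigma> by (intro mult_right_mono) auto
  moreover have "(\<eta> k)\<^sup>2 = \<beta>\<^sup>2 / C\<^sup>2 * \<sigma> ^ (2 * k)" "(\<beta> * \<sigma> ^ k)\<^sup>2 = \<beta>\<^sup>2 * \<sigma> ^ (2 * k)"
    by (simp_all add: \<eta>_def power_mult_distrib power_divide power_mult[symmetric] mult.commute)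
  ultimately show "F (x (Suc k)) - F y \<le> (12 * \<beta> ^ 3 / (1 - 2 * \<beta>) + \<beta>\<^sup>2 / C\<^sup>2 + \<beta>\<^sup>2) * \<sigma> ^ (2 * k)"
    using newton(3)[OF inv, of k] by (simp add: distrib_right)
qed

end

section \<open>Total work and order of growth\<close>

text \<open>The work of the stages grows geometrically, so it is dominated by the last one, whose tolerance
  is proportional to the target accuracy.\<close>

lemma geometric_complexity:
  fixes calls :: "nat \<Rightarrow> real" and err :: "nat \<Rightarrow> real"
  assumes \<rho>: "1 < \<rho>" and A: "0 < A" and K: "0 < K" and \<epsilon>: "0 < \<epsilon>"
    and calls: "\<And>k. calls k \<le> A * \<rho> ^ k" and err: "\<And>k. err (Suc k) \<le> K / \<rho> ^ k"
  shows "\<exists>k. err k \<le> \<epsilon> \<and> (\<Sum>j<k. calls j) \<le> A * \<rho> / (\<rho> - 1) * (1 + K * \<rho> / \<epsilon>)"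
proof -
  obtain n where "(1 / \<rho>) ^ n < \<epsilon> / K"
    using real_arch_pow_inv[of "\<epsilon> / K" "1 / \<rho>"] \<rho> K \<epsilon> by auto
  hence "K / \<rho> ^ n \<le> \<epsilon>" using K by (simp add: field_simps power_divide)
  then obtain j where j: "K / \<rho> ^ j \<le> \<epsilon>" "\<forall>i<j. \<not> K / \<rho> ^ i \<le> \<epsilon>"
    using exists_least_iff[of "\<lambda>j. K / \<rho> ^ j \<le> \<epsilon>"] by blast
  \<comment> \<open>\<open>j\<close> is the first stage whose guarantee reaches \<epsilon>. The
    guarantee of the previous stage fails, which bounds \<open>\<rho> ^ (j - 1)\<close> by
    \<open>K / \<epsilon>\<close>; the summand 1 covers \<open>j = 0\<close>.\<close>
  have pj: "\<rho> ^ j \<le> 1 + K * \<rho> / \<epsilon>"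
  proof (cases j)
    case 0
    thus ?thesis using K \<rho> \<epsilon> by simp
  next
    case (Suc i)
    hence "\<epsilon> < K / \<rho> ^ i" using j(2) by auto
    hence "\<rho> ^ i < K / \<epsilon>" using \<rho> \<epsilon> by (simp add: field_simps)
    hence "\<rho> ^ i * \<rho> \<le> K / \<epsilon> * \<rho>" using \<rho> by (intro mult_right_mono) auto
    thus ?thesis using Suc by (simp add: mult.commute)
  qed
  \<comment> \<open>The guarantee of stage \<open>j\<close> concerns the iterate
    \<open>Suc j\<close>, so stages 0 to \<open>j\<close> are paid for.\<close>
  have "(\<Sum>i<Suc j. calls i) \<le> (\<Sum>i<Suc j. A * \<rho> ^ i)" by (intro sum_mono calls)
  also have "\<dots> = A * ((\<rho> ^ Suc j - 1) / (\<rho> - 1))" 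
    unfolding sum_distrib_left[symmetric] using \<rho> by (subst geometric_sum) auto
  also have "\<dots> \<le> A * (\<rho> * (1 + K * \<rho> / \<epsilon>) / (\<rho> - 1))"
  proof -
    have "\<rho> * \<rho> ^ j \<le> \<rho> * (1 + K * \<rho> / \<epsilon>)" using pj \<rho> by (intro mult_left_mono) auto
    hence "\<rho> ^ Suc j - 1 \<le> \<rho> * (1 + K * \<rho> / \<epsilon>)" by simp
    thus ?thesis using A \<rho> by (intro mult_left_mono divide_right_mono) auto
  qed
  finally show ?thesis using order_trans[OF err j(1)] by (intro exI[of _ "Suc j"]) simp
qed

text \<open>Near 0 both 1 and \<open>1 / \<epsilon>\<close> are at most
  \<open>\<epsilon> powr - \<nu>\<close>, since \<open>\<nu> \<ge> 1\<close>.\<close>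

lemma reciprocal_bigo_powr:
  fixes \<nu> a b :: real
  assumes "1 \<le> \<nu>" "0 \<le> a" "0 \<le> b"
  shows "(\<lambda>\<epsilon>. a * (1 + b / \<epsilon>)) \<in> O[at_right 0](\<lambda>\<epsilon>. \<epsilon> powr - \<nu>)"
proof (rule bigoI)
  have "\<forall>\<^sub>F \<epsilon> in at_right (0::real). \<epsilon> \<in> {0<..<1}" by (rule eventually_at_right_real) simp
  thus "\<forall>\<^sub>F \<epsilon> in at_right 0. norm (a * (1 + b / \<epsilon>)) \<le> (a * (1 + b)) * norm (\<epsilon> powr - \<nu>)"
  proof eventually_elim
    case (elim \<epsilon>)
    hence e: "0 < \<epsilon>" "\<epsilon> < 1" by auto
    have "a * (1 + b / \<epsilon>) \<le> a * ((1 + b) * (1 / \<epsilon>))"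
      using assms e by (intro mult_left_mono) (auto simp: field_simps)
    also have "1 / \<epsilon> = \<epsilon> powr - 1" using e by (simp add: powr_minus_divide)
    also have "\<epsilon> powr - 1 \<le> \<epsilon> powr - \<nu>" using e assms by (intro powr_mono') auto
    finally have "a * (1 + b / \<epsilon>) \<le> a * (1 + b) * \<epsilon> powr - \<nu>"
      using assms by (simp add: mult_left_mono mult.assoc)
    moreover have "0 \<le> a * (1 + b / \<epsilon>)" using assms e by simp
    ultimately show ?case using e by simp
  qed
qed

theorem theorem4p4:
  fixes f :: "real^'n \<Rightarrow> ereal" and X :: "(real^'n) set"
    and x0 xstar :: "real^'n" and \<sigma> \<beta> C :: real and \<eta> :: "nat \<Rightarrow> real"
  assumes f_proper: "proper_fun f" and f_closed: "closed_fun f" and f_convex: "convex_fun f"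
    and f_C3: "open (effdom f)" "C_on 3 (real_part f) (effdom f)"
    and f_sc: "std_self_concordant f"
    and f_nondeg: "\<And>x. x \<in> effdom f \<Longrightarrow> invertible (hess f x)"
    and X: "X \<noteq> {}" "compact X" "convex X"
    and xstar: "is_arg_min f (\<lambda>x. x \<in> X) xstar"
    and x0: "x0 \<in> effdom f \<inter> X"
    and init: "local_norm f xstar (x0 - xstar) \<le> \<beta>"
    and \<sigma>: "0 < \<sigma>" "\<sigma> < 1" and \<beta>: "0 < \<beta>" "\<beta> < 1/2" and C: "C > 1"
    and cond1: "1 / (C * (1 - \<beta>)) + \<beta> / ((1 - 2 * \<beta>) * (1 - \<beta>)\<^sup>2) \<le> \<sigma>"
    and cond2: "1 / C + 1 / (1 - 2 * \<beta>) \<le> 2"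
    and \<eta>: "\<And>k. \<eta> k = \<beta> * \<sigma> ^ k / C"
  shows "(\<forall>x u v. full_step_scheme f X x0 \<eta> x u v \<longrightarrow>
            (\<forall>k. (\<exists>t. stage_stops_at f \<eta> x u v k t) \<and>
                 f (x (Suc k)) - f xstar \<le>
                   ereal ((12 * \<beta> ^ 3 / (1 - 2 * \<beta>) + \<beta>\<^sup>2 / C\<^sup>2 + \<beta>\<^sup>2) * \<sigma> ^ (2 * k))))
       \<and> (\<exists>N. N \<in> O[at_right 0](\<lambda>\<epsilon>. \<epsilon> powr - (1 + ln (1 - 2 * \<beta>) / ln \<sigma>)) \<and>
            (\<forall>x u v. full_step_scheme f X x0 \<eta> x u v \<longrightarrow>
               (\<forall>\<epsilon>>0. \<exists>k. f (x k) - f xstar \<le> ereal \<epsilon> \<and>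
                        real (lmo_calls_before f \<eta> x u v k) \<le> N \<epsilon>)))"
proof -
  have x0': "x0 \<in> effdom f" "x0 \<in> X" using x0 by auto
  have "xstar \<in> effdom f"
    using x0' xstar by (auto simp: is_arg_min_def effdom_def not_less intro: le_less_trans)
  then interpret newton_fw f X xstar \<sigma> \<beta> C
    using assms by unfold_locales auto
  obtain R where R: "R > 0"
    "\<And>x a b. x \<in> X \<Longrightarrow> x \<in> D \<Longrightarrow> N xstar (x - xstar) \<le> \<beta> \<Longrightarrow> a \<in> X \<Longrightarrow> b \<in> X \<Longrightarrow>
       H x (a - b) (a - b) \<le> R \<and> fw_gap (grad f x) (hess f x) x a b \<le> R"
    using subproblem_bounds by blast
  have \<eta>_eq: "\<eta> = (\<lambda>k. \<beta> * \<sigma> ^ k / C)" using \<eta> by blast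
  define K where "K = 12 * \<beta> ^ 3 / (1 - 2 * \<beta>) + \<beta>\<^sup>2 / C\<^sup>2 + \<beta>\<^sup>2"
  have K: "K > 0" using \<beta> C by (simp add: K_def add_pos_pos)
  note S = stage[OF _ x0' init R, folded \<eta>_eq K_def]
  have diff: "f (x k) - f xstar = ereal (F (x k) - F xstar)" if "full_step_scheme f X x0 \<eta> x u v" for x u v k
    using f_eq_F[of "x k"] f_eq_F[OF y_dom] S(1)[OF that, of k] by simp
  define \<rho> where "\<rho> = 1 / \<sigma>\<^sup>2"
  have \<rho>: "1 < \<rho>" using \<sigma> by (simp add: \<rho>_def power_less_one_iff)
  have \<rho>_pow: "\<rho> ^ k = 1 / \<sigma> ^ (2 * k)" for k by (simp add: \<rho>_def power_divide power_mult)
  \<comment> \<open>\<open>4 * R / (\<eta> k)\<^sup>2\<close> is the first summand times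
    \<open>\<rho> ^ k\<close>; the additive 2 is absorbed because
    \<open>\<rho> ^ k \<ge> 1\<close>.\<close>
  define A where "A = 4 * R * C\<^sup>2 / \<beta>\<^sup>2 + 2"
  have A: "A > 0" using R \<beta> C by (simp add: A_def add_pos_pos)
  \<comment> \<open>Built from \<open>A\<close>, \<open>K\<close> and \<rho>, which are fixed before
    any run, so that one bound serves all runs.\<close>
  define M where "M \<epsilon> = A * \<rho> / (\<rho> - 1) * (1 + K * \<rho> / \<epsilon>)" for \<epsilon>
  have calls: "real (stage_lmo_calls f \<eta> x u v k) \<le> A * \<rho> ^ k" if "full_step_scheme f X x0 \<eta> x u v" for x u v k
  proof -
    have "4 * R / (\<eta> k)\<^sup>2 = 4 * R * C\<^sup>2 / \<beta>\<^sup>2 * \<rho> ^ k"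
      using \<sigma> by (simp add: \<eta> \<rho>_pow power_divide power_mult_distrib power_mult[symmetric] mult.commute)
    moreover have "1 \<le> \<rho> ^ k" using \<rho> by simp
    ultimately show ?thesis using S(3)[OF that, of k, folded \<eta>] by (simp add: A_def distrib_right)
  qed
  \<comment> \<open>Both logarithms are negative, so the exponent \<nu> is at least 1 and growth of
    order \<open>1 / \<epsilon>\<close> suffices.\<close>
  have "0 \<le> ln (1 - 2 * \<beta>) / ln \<sigma>" using \<beta> \<sigma> by (intro divide_nonpos_neg) auto
  hence "M \<in> O[at_right 0](\<lambda>\<epsilon>. \<epsilon> powr - (1 + ln (1 - 2 * \<beta>) / ln \<sigma>))"
    unfolding M_def using A \<rho> K by (intro reciprocal_bigo_powr) auto
  moreover have "\<exists>k. f (x k) - f xstar \<le> ereal \<epsilon> \<and> real (lmo_calls_before f \<eta> x u v k) \<le> M \<epsilon>"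
    if run: "full_step_scheme f X x0 \<eta> x u v" and \<epsilon>: "0 < \<epsilon>" for x u v \<epsilon>
  proof -
    have "\<exists>k. F (x k) - F xstar \<le> \<epsilon> \<and> (\<Sum>j<k. real (stage_lmo_calls f \<eta> x u v j)) \<le> M \<epsilon>"
      unfolding M_def
      by (rule geometric_complexity[OF \<rho> A K \<epsilon> calls[OF run]]) (use S(4)[OF run] in \<open>simp add: \<rho>_pow\<close>)
    thus ?thesis by (simp add: diff[OF run] lmo_calls_before_def)
  qed
  moreover have "(\<exists>t. stage_stops_at f \<eta> x u v k t) \<and> f (x (Suc k)) - f xstar \<le> ereal (K * \<sigma> ^ (2 * k))"
    if run: "full_step_scheme f X x0 \<eta> x u v" for x u v k
    using S(2,4)[OF run, of k] by (simp add: diff[OF run])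
  ultimately show ?thesis unfolding K_def by blast
qed

end
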